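(* For any time scale $\mathbb{T}$ such that $\{0,1\}\subset\mathbb{T}\subset[0,1]$, any $a\in(-1,1)$, and any $(\mathcal{A}_t)_{t\in\mathbb{T}}$-sampled Brownian motion $(B_t)_{t\in\mathbb{T}}$ defined on a complete filtered probability space $(\Omega,\mathcal{A},(\mathcal{A}_t)_{t\in\mathbb{T}},\mathcal{P})$, the stochastic differential equation $$X_t=B_t+\int_{[0,t)_{\mathbb{T}}}a\sin(X_s-X_{\rho(s)})\,\lambda_\Delta(ds),\quad\forall t\in\mathbb{T},\ \mathcal{P}\text{-a.s.},$$ has a strong solution $(X_t)_{t\in\mathbb{T}}$, whose law $p_X$ on $C_{\mathbb{T}}$ is equivalent to the sampled Wiener measure $\mu_{\mathbb{T}}$. Here $\rho$ denotes the backward jump operator of $\mathbb{T}$.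
   Context: A time scale here is a closed subset $\mathbb{T}$ of $\mathbb{R}$; $I_{\mathbb{T}}:=I\cap\mathbb{T}$ for an interval $I\subset[0,1]$. Let $\bar\rho:[0,1]\to\mathbb{T}$ be $\bar\rho(t):=\sup\{u\in\mathbb{T}:u<t\}$ for $t\in(0,1]$ and $\bar\rho(0):=0$; the backward jump operator is $\rho:=\bar\rho|_{\mathbb{T}}$, and $\lambda_\Delta:=\bar\rho_\star\lambda$ is the pushforward to $(\mathbb{T},\mathcal{B}(\mathbb{T}))$ of Lebesgue measure $\lambda$ on $[0,1]$. $C_{\mathbb{T}}$ is the Banach space of continuous $\omega:\mathbb{T}\to\mathbb{R}$ with $\omega(0)=0$, with the sup norm; $W_t(\omega):=\omega(t)$ and $\mathcal{F}_t:=\sigma(W_s:s\in[0,t]_{\mathbb{T}})$. The sampled Wiener measure $\mu_{\mathbb{T}}$ is the law on $C_{\mathbb{T}}$ of $(b_t)_{t\in\mathbb{T}}$, where $(b_t)_{t\in[0,1]}$ is a standard Brownian motion started at $0$. $\mathcal{F}_t^{\mu_{\mathbb{T}}}$ is the smallest $\sigma$-field containing $\mathcal{F}_t$ and all $\mu_{\mathbb{T}}$-negligible sets of the $\mu_{\mathbb{T}}$-completed Borel $\sigma$-field. A sampled Brownian motion $(B_t)_{t\in\mathbb{T}}$ is a process whose law, as a random element of $C_{\mathbb{T}}$, is $\mu_{\mathbb{T}}$. It is an $(\mathcal{A}_t)_{t\in\mathbb{T}}$-sampled Brownian motion on a complete filtered probability space $(\Omega,\mathcal{A},(\mathcal{A}_t)_{t\in\mathbb{T}},\mathcal{P})$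 (each $\mathcal{A}_t$ complete) if it is $(\mathcal{A}_t)$-adapted and $E_{\mathcal{P}}[\exp(i\lambda(B_t-B_s))\mid\mathcal{A}_s]=\exp(-(t-s)\lambda^2/2)$ $\mathcal{P}$-a.s. for all $\lambda\in\mathbb{R}$ and $s<t$ in $\mathbb{T}$. A strong solution for $(B_t)_{t\in\mathbb{T}}$ is an $(\mathcal{A}_t)$-adapted process $(X_t)_{t\in\mathbb{T}}$ on $(\Omega,\mathcal{A},\mathcal{P})$ satisfying the equation for which there is a Borel measurable $F:C_{\mathbb{T}}\to C_{\mathbb{T}}$ with $F^{-1}(\mathcal{F}_t)\subset\mathcal{F}_t^{\mu_{\mathbb{T}}}$ for all $t\in\mathbb{T}$ and $X_t=W_t(F(B))$ for all $t\in\mathbb{T}$, $\mathcal{P}$-a.s. *)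

theory Defs
  imports "HOL-Probability.Probability"
begin

subsection \<open>Time scales\<close>

definition rho_bar :: "real set \<Rightarrow> real \<Rightarrow> real" where
  "rho_bar T t = (if t = 0 then 0 else Sup {u \<in> T. u < t})"

definition backward_jump :: "real set \<Rightarrow> real \<Rightarrow> real" where
  "backward_jump T = restrict (rho_bar T) T"

definition lambda_Delta :: "real set \<Rightarrow> real measure" where
  "lambda_Delta T = distr (restrict_space lborel {0..1}) (restrict_space borel T) (rho_bar T)"


subsection \<open>The path space\<close>

text \<open>
  Paths indexed by \<open>T\<close> are functions on \<open>real\<close> that are \<open>undefined\<close> outside \<open>T\<close>. For compact \<open>T\<close>,
  the library's space of bounded continuous functions with the sup metric consists of all
  continuous functions on \<open>T\<close>.
\<close>

definition path_space :: "real set \<Rightarrow> (real \<Rightarrow> real) metric" where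
  "path_space T = submetric (cfunspace (top_of_set T) euclidean_metric) {\<omega>. \<omega> 0 = 0}"

definition path_borel :: "real set \<Rightarrow> (real \<Rightarrow> real) measure" where
  "path_borel T = sigma (mspace (path_space T)) {U. openin (mtopology_of (path_space T)) U}"

text \<open>The \<open>\<sigma>\<close>-field generated by the coordinates \<open>W\<^sub>s(\<omega>) = \<omega>(s)\<close>, \<open>s \<in> [0,t] \<inter> T\<close>.\<close>

definition path_filtration :: "real set \<Rightarrow> real \<Rightarrow> (real \<Rightarrow> real) measure" where
  "path_filtration T t = sigma (mspace (path_space T))
     {{\<omega> \<in> mspace (path_space T). \<omega> s \<in> U} | s U. s \<in> {0..t} \<inter> T \<and> U \<in> sets borel}"

definition augmented_path_filtration ::
    "real set \<Rightarrow> (real \<Rightarrow> real) measure \<Rightarrow> real \<Rightarrow> (real \<Rightarrow> real) measure" where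
  "augmented_path_filtration T \<mu> t = sigma (mspace (path_space T))
     (sets (path_filtration T t) \<union> null_sets (completion \<mu>))"

definition sample_path :: "real set \<Rightarrow> (real \<Rightarrow> 'w \<Rightarrow> real) \<Rightarrow> 'w \<Rightarrow> (real \<Rightarrow> real)" where
  "sample_path T X \<omega> = (\<lambda>t\<in>T. X t \<omega>)"

definition path_process :: "real set \<Rightarrow> 'w measure \<Rightarrow> (real \<Rightarrow> 'w \<Rightarrow> real) \<Rightarrow> bool" where
  "path_process T P X \<longleftrightarrow> sample_path T X \<in> P \<rightarrow>\<^sub>M path_borel T"

definition path_law :: "real set \<Rightarrow> 'w measure \<Rightarrow> (real \<Rightarrow> 'w \<Rightarrow> real) \<Rightarrow> (real \<Rightarrow> real) measure" where
  "path_law T P X = distr P (path_borel T) (sample_path T X)"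

definition equivalent_measures :: "'a measure \<Rightarrow> 'a measure \<Rightarrow> bool" where
  "equivalent_measures M N \<longleftrightarrow>
     sets M = sets N \<and> absolutely_continuous M N \<and> absolutely_continuous N M"


subsection \<open>Sampled Wiener measure\<close>

definition standard_brownian_motion :: "'w measure \<Rightarrow> (real \<Rightarrow> 'w \<Rightarrow> real) \<Rightarrow> bool" where
  "standard_brownian_motion N b \<longleftrightarrow>
     prob_space N \<and>
     (\<forall>t\<in>{0..1}. b t \<in> borel_measurable N) \<and>
     (\<forall>\<omega>\<in>space N. b 0 \<omega> = 0 \<and> continuous_on {0..1} (\<lambda>t. b t \<omega>)) \<and>
     (\<forall>s t. 0 \<le> s \<and> s < t \<and> t \<le> 1 \<longrightarrow>
        distributed N lborel (\<lambda>\<omega>. b t \<omega> - b s \<omega>) (normal_density 0 (sqrt (t - s)))) \<and>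
     (\<forall>(n::nat) u. (\<forall>i\<le>n. u i \<in> {0..1}) \<and> (\<forall>i<n. u i < u (Suc i)) \<longrightarrow>
        prob_space.indep_vars N (\<lambda>_. borel) (\<lambda>i \<omega>. b (u (Suc i)) \<omega> - b (u i) \<omega>) {..<n})"

text \<open>
  The law does not depend on the chosen Brownian motion. The sample space type \<open>real \<Rightarrow> real\<close>
  is no restriction, since it contains the canonical space of continuous paths on \<open>[0,1]\<close>.
\<close>

definition sampled_wiener :: "real set \<Rightarrow> (real \<Rightarrow> real) measure" where
  "sampled_wiener T = (THE \<mu>. \<exists>(N :: (real \<Rightarrow> real) measure) b.
     standard_brownian_motion N b \<and> \<mu> = path_law T N b)"


subsection \<open>Filtered probability spaces and sampled Brownian motions\<close>

text \<open>
  \<open>\<A> t\<close> is a measure only in order to carry a \<open>\<sigma>\<close>-field; its values as a measure play no role.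
  Completeness of \<open>\<A> t\<close> means that it contains all \<open>P\<close>-negligible sets.
\<close>

definition complete_filtered_prob_space ::
    "real set \<Rightarrow> 'w measure \<Rightarrow> (real \<Rightarrow> 'w measure) \<Rightarrow> bool" where
  "complete_filtered_prob_space T P \<A> \<longleftrightarrow>
     prob_space P \<and> complete_measure P \<and>
     (\<forall>t\<in>T. subalgebra P (\<A> t) \<and> null_sets P \<subseteq> sets (\<A> t)) \<and>
     (\<forall>s\<in>T. \<forall>t\<in>T. s \<le> t \<longrightarrow> sets (\<A> s) \<subseteq> sets (\<A> t))"

definition adapted_process ::
    "real set \<Rightarrow> (real \<Rightarrow> 'w measure) \<Rightarrow> (real \<Rightarrow> 'w \<Rightarrow> real) \<Rightarrow> bool" where
  "adapted_process T \<A> X \<longleftrightarrow> (\<forall>t\<in>T. X t \<in> borel_measurable (\<A> t))"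

definition complex_cond_exp ::
    "'w measure \<Rightarrow> 'w measure \<Rightarrow> ('w \<Rightarrow> complex) \<Rightarrow> 'w \<Rightarrow> complex" where
  "complex_cond_exp P F f \<omega> =
     Complex (real_cond_exp P F (\<lambda>x. Re (f x)) \<omega>) (real_cond_exp P F (\<lambda>x. Im (f x)) \<omega>)"

definition sampled_brownian_motion ::
    "real set \<Rightarrow> 'w measure \<Rightarrow> (real \<Rightarrow> 'w \<Rightarrow> real) \<Rightarrow> bool" where
  "sampled_brownian_motion T P B \<longleftrightarrow>
     path_process T P B \<and> path_law T P B = sampled_wiener T"

definition filtered_sampled_brownian_motion ::
    "real set \<Rightarrow> 'w measure \<Rightarrow> (real \<Rightarrow> 'w measure) \<Rightarrow> (real \<Rightarrow> 'w \<Rightarrow> real) \<Rightarrow> bool" where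
  "filtered_sampled_brownian_motion T P \<A> B \<longleftrightarrow>
     sampled_brownian_motion T P B \<and> adapted_process T \<A> B \<and>
     (\<forall>\<theta>::real. \<forall>s\<in>T. \<forall>t\<in>T. s < t \<longrightarrow>
        (AE \<omega> in P. complex_cond_exp P (\<A> s) (\<lambda>x. exp (\<i> * complex_of_real (\<theta> * (B t x - B s x)))) \<omega>
                    = complex_of_real (exp (- (t - s) * \<theta>\<^sup>2 / 2))))"


subsection \<open>Strong solutions\<close>

text \<open>
  \<open>eqn x w\<close> is the equation for a solution path \<open>x\<close> and a driving path \<open>w\<close>; the quantification over
  all times is part of \<open>eqn\<close>, so the exceptional null set is common to all times.
\<close>

definition strong_solution ::
    "real set \<Rightarrow> 'w measure \<Rightarrow> (real \<Rightarrow> 'w measure) \<Rightarrow> (real \<Rightarrow> 'w \<Rightarrow> real) \<Rightarrow>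
     ((real \<Rightarrow> real) \<Rightarrow> (real \<Rightarrow> real) \<Rightarrow> bool) \<Rightarrow> (real \<Rightarrow> 'w \<Rightarrow> real) \<Rightarrow> bool" where
  "strong_solution T P \<A> B eqn X \<longleftrightarrow>
     adapted_process T \<A> X \<and>
     (AE \<omega> in P. eqn (\<lambda>t. X t \<omega>) (\<lambda>t. B t \<omega>)) \<and>
     (\<exists>F \<in> path_borel T \<rightarrow>\<^sub>M path_borel T.
        (\<forall>t\<in>T. \<forall>U \<in> sets (path_filtration T t).
           F -` U \<inter> mspace (path_space T) \<in> sets (augmented_path_filtration T (sampled_wiener T) t)) \<and>
        (AE \<omega> in P. \<forall>t\<in>T. X t \<omega> = F (sample_path T B \<omega>) t))"

text \<open>
  The integrability requirement excludes the default value 0 of the library's integral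
  for non-integrable functions.
\<close>

definition sine_equation ::
    "real set \<Rightarrow> real \<Rightarrow> (real \<Rightarrow> real) \<Rightarrow> (real \<Rightarrow> real) \<Rightarrow> bool" where
  "sine_equation T a x w \<longleftrightarrow>
     (\<forall>t\<in>T.
        set_integrable (lambda_Delta T) ({0..<t} \<inter> T) (\<lambda>s. a * sin (x s - x (backward_jump T s))) \<and>
        x t = w t + (LINT s:{0..<t} \<inter> T|lambda_Delta T. a * sin (x s - x (backward_jump T s))))"

end

theory Submission
  imports Defs
begin

text \<open>
  Only a point \<open>s\<close> that is isolated in \<open>T\<close> contributes to the drift: for other \<open>s\<close> either \<open>\<rho>(s) = s\<close>, or
  \<open>{s}\<close> is \<open>\<lambda>\<^sub>\<Delta>\<close>-null. The increments \<open>X\<^sub>s - X\<^bsub>\<rho>(s)\<^esub>\<close> solve a fixed point equation that is a contraction with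
  constant \<open>\<bar>a\<bar> < 1\<close> for every single driving path, because gaps of \<open>T\<close> have length at most 1. So Picard
  iteration gives a bimeasurable adapted bijection \<open>F\<close> of the path space with \<open>X = F(B)\<close>, whose inverse
  subtracts the drift.

  Since \<open>F\<close> is a bijection, it is enough that \<open>F\<^sup>-\<^sup>1(B)\<close> and \<open>B\<close> have the same null sets. If only the drift over
  finitely many gaps is subtracted, this is Girsanov's theorem for finitely many Gaussian increments, with a
  density \<open>M\<close> such that \<open>M\<^sup>2\<close> and \<open>1 / M\<close> have expectation at most \<open>e\<close>. The resulting bounds between the two
  laws do not depend on the number of gaps and survive the limit.

  The Gaussian increments come from the conditional characteristic functions of \<open>B\<close>, and \<open>sampled_wiener T\<close>
  is the law of \<open>B\<close> by hypothesis; so Brownian motion on \<open>[0,1]\<close> is never constructed.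
\<close>

subsection \<open>Gaps of a time scale\<close>

text \<open>Points of \<open>T\<close> may accumulate from the right, as in {0} together with all
  1/n. Then the chain \<open>r\<close>, \<open>rho r\<close>, \<open>rho (rho r)\<close>, ... never
  ends, and a recursion along time has no first increment to start from. Tsirelson's equation has
  such an endless past, and there no strong solution exists. Here the contraction helps: the
  influence of remote increments decays geometrically. The laws are compared through the inverse of
  \<open>F\<close> because the drift that it subtracts is explicit in \<open>B\<close>, with a
  coefficient known at the left end of each gap, while the drift of \<open>X\<close> is known only
  through the fixed point. No limit of densities is formed. What passes to the limit is P(A) \<le> N
  Q(A) + (1 + e)/N-type control, for all N > 0 and in both directions; this is enough for null sets.
  The constant e reflects that the gaps have total length at most 1. The comparison takes place in
  \<open>nat \<Rightarrow> real\<close>, the values at a dense sequence of times: this space is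
  Polish, so its probability measures are regular, and coordinatewise convergence is all that the
  truncated shifts have to satisfy.\<close>

locale time_scale =
  fixes T :: "real set"
  assumes closed_T: "closed T" and zero_mem: "0 \<in> T" and one_mem: "1 \<in> T"
    and T_subset: "T \<subseteq> {0..1}"
begin

abbreviation rho :: "real \<Rightarrow> real" where "rho \<equiv> rho_bar T"

definition left_scattered :: "real set" where
  "left_scattered = {s \<in> T. rho s < s}"

lemma T_bounds: "t \<in> T \<Longrightarrow> 0 \<le> t" "t \<in> T \<Longrightarrow> t \<le> 1"
  using T_subset by auto

lemma compact_T: "compact T"
  using closed_T T_subset bounded_closed_interval bounded_subset compact_eq_bounded_closed by metis

lemma bdd_above_less: "bdd_above {u \<in> T. u < t}"
  by (rule bdd_aboveI[of _ t]) auto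

lemma rho_upper: "u \<in> T \<Longrightarrow> u < t \<Longrightarrow> u \<le> rho t"
  using T_bounds(1)[of u] cSup_upper[OF _ bdd_above_less, of u t] by (auto simp: rho_bar_def)

lemma rho_le: "0 \<le> t \<Longrightarrow> rho t \<le> t"
  unfolding rho_bar_def using zero_mem by (cases "t = 0") (auto intro!: cSup_least)

lemma rho_mem: "0 \<le> t \<Longrightarrow> rho t \<in> T"
proof (cases "t = 0")
  case True
  then show ?thesis by (simp add: rho_bar_def zero_mem)
next
  case False
  assume "0 \<le> t"
  with False have ne: "{u \<in> T. u < t} \<noteq> {}" using zero_mem by force
  have "Sup {u \<in> T. u < t} \<in> closure {u \<in> T. u < t}"
    by (rule closure_contains_Sup[OF ne bdd_above_less])
  also have "\<dots> \<subseteq> closure T" by (rule closure_mono) auto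
  finally show ?thesis using False closed_T by (simp add: rho_bar_def)
qed

lemma rho_nonneg: "0 \<le> t \<Longrightarrow> 0 \<le> rho t"
  using rho_mem T_bounds by blast

lemma rho_mono: "0 \<le> s \<Longrightarrow> s \<le> t \<Longrightarrow> rho s \<le> rho t"
proof (cases "s = t")
  case False
  assume "0 \<le> s" "s \<le> t"
  then show ?thesis using rho_upper[OF rho_mem[of s], of t] rho_le[of s] False by linarith
qed simp

lemma left_scatteredD:
  assumes "r \<in> left_scattered"
  shows "r \<in> T" "rho r < r" "rho r \<in> T" "0 \<le> rho r" "r \<le> 1" "r - rho r \<le> 1" "0 < r" "r - rho r > 0"
  using assms T_bounds[of r] rho_mem[of r] T_bounds[of "rho r"] unfolding left_scattered_def by auto

text \<open>The open gap below \<open>r\<close> contains no point of \<open>T\<close>. Hence at a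
  time of \<open>T\<close> every gap is either complete or has not begun.\<close>

lemma left_scattered_le_iff:
  assumes "r \<in> left_scattered" "t \<in> T" shows "r \<le> t \<longleftrightarrow> rho r < t"
  using left_scatteredD(2)[OF assms(1)] rho_upper[OF assms(2), of r] by linarith

lemma rho_const:
  assumes "r \<in> left_scattered" "rho r < v" "v \<le> r" shows "rho v = rho r"
  using rho_upper[OF left_scatteredD(3)[OF assms(1)] assms(2)] rho_mono[of v r] assms(3,2)
    left_scatteredD(4)[OF assms(1)] by linarith

text \<open>The right end of the gap around \<open>v\<close> is the first point of \<open>T\<close>
  from \<open>v\<close> on, which exists because \<open>T\<close> is closed and contains 1. So the
  half-open gaps cover all times at which the drift can change.\<close>

lemma gap_cover:
  assumes "0 \<le> v" "v \<le> 1" "rho v < v"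
  obtains r where "r \<in> left_scattered" "rho r < v" "v \<le> r" "rho r = rho v"
proof -
  define r where "r = Inf (T \<inter> {v..1})"
  have ne: "T \<inter> {v..1} \<noteq> {}" using one_mem assms by auto
  have bdd: "bdd_below (T \<inter> {v..1})" by (rule bdd_belowI[of _ v]) auto
  have "closed (T \<inter> {v..1})" using closed_T by (intro closed_Int) auto
  then have r: "r \<in> T \<inter> {v..1}" unfolding r_def by (rule closed_contains_Inf[OF ne bdd])
  have "u \<le> rho v" if "u \<in> T" "u < r" for u
  proof -
    have "u < v"
    proof (rule ccontr)
      assume "\<not> u < v"
      then have "u \<in> T \<inter> {v..1}" using that T_bounds by auto
      then have "r \<le> u" unfolding r_def by (rule cInf_lower[OF _ bdd])
      with that show False by simp
    qed
    then show ?thesis using rho_upper that by blast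
  qed
  \<comment> \<open>\<open>v = 0\<close> contradicts \<open>rho v < v\<close>, since
    \<open>rho 0 = 0\<close>; so 0 is a point of \<open>T\<close> below \<open>r\<close>.\<close>
  moreover have "{u \<in> T. u < r} \<noteq> {}" using zero_mem assms r by (cases "v = 0") (auto simp: rho_bar_def)
  moreover have "r \<noteq> 0" using assms r by (auto simp: rho_bar_def)
  ultimately have "rho r \<le> rho v" unfolding rho_bar_def[of T r]
    by simp (rule cSup_least, auto)
  moreover have "rho v \<le> rho r" using rho_mono r assms by auto
  ultimately show ?thesis using that[of r] r assms by (auto simp: left_scattered_def)
qed

lemma gaps_disjoint:
  assumes "r \<in> left_scattered" "s \<in> left_scattered" "r \<noteq> s" shows "{rho r<..r} \<inter> {rho s<..s} = {}"
  using left_scattered_le_iff[OF assms(1) left_scatteredD(1)[OF assms(2)]]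
    left_scattered_le_iff[OF assms(2) left_scatteredD(1)[OF assms(1)]] assms(3) by force

lemma countable_left_scattered: "countable left_scattered"
proof -
  have gap: "r = s" if "r \<in> left_scattered" "s \<in> left_scattered" "rho r < v" "v < r" "rho s < v" "v < s" for r s v
  proof (rule ccontr)
    assume "r \<noteq> s"
    then consider "r < s" | "s < r" by linarith
    then show False
      using rho_upper[of r s] rho_upper[of s r] left_scatteredD[OF that(1)] left_scatteredD[OF that(2)] that
      by cases auto
  qed
  have "countable ((\<lambda>r. {rho r<..<r}) ` left_scattered)"
  proof (rule countable_disjoint_open_subsets)
    show "pairwise disjnt ((\<lambda>r. {rho r<..<r}) ` left_scattered)"
    proof (rule pairwiseI)
      fix I J assume "I \<in> (\<lambda>r. {rho r<..<r}) ` left_scattered" "J \<in> (\<lambda>r. {rho r<..<r}) ` left_scattered" "I \<noteq> J"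
      then obtain r s where "r \<in> left_scattered" "s \<in> left_scattered" "I = {rho r<..<r}" "J = {rho s<..<s}"
        by (elim imageE)
      with \<open>I \<noteq> J\<close> show "disjnt I J" using gap[of r s] by (auto simp: disjnt_iff simp del: greaterThanLessThan_eq_iff)
    qed
  qed auto
  moreover have "inj_on (\<lambda>r. {rho r<..<r}) left_scattered"
  proof (rule inj_onI)
    fix r s assume rs: "r \<in> left_scattered" "s \<in> left_scattered" "{rho r<..<r} = {rho s<..<s}"
    have "(rho r + r) / 2 \<in> {rho r<..<r}" using left_scatteredD(2)[OF rs(1)] by simp
    then have "(rho r + r) / 2 \<in> {rho s<..<s}" unfolding rs(3) .
    then show "r = s" using rs left_scatteredD(2)[of r] by (intro gap[of r s "(rho r + r) / 2"]) auto
  qed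
  ultimately show ?thesis by (rule countable_image_inj_on)
qed

end

subsection \<open>The drift and the pathwise solution\<close>

lemma abs_sin_diff_le: "\<bar>sin x - sin y\<bar> \<le> \<bar>x - y\<bar>" for x y :: real
proof -
  have "\<bar>sin x - sin y\<bar> = 2 * \<bar>sin ((x - y) / 2)\<bar> * \<bar>cos ((x + y) / 2)\<bar>"
    by (simp add: sin_diff_sin abs_mult)
  also have "\<dots> \<le> 2 * \<bar>(x - y) / 2\<bar> * 1"
    by (intro mult_mono mult_left_mono abs_sin_x_le_abs_x) auto
  finally show ?thesis by simp
qed

lemma set_integral_abs_le:
  fixes f :: "real \<Rightarrow> real"
  assumes "s \<le> t" "A = {s<..t} \<or> A = {s..t}" "set_integrable lborel A f" "\<And>v. v \<in> A \<Longrightarrow> \<bar>f v\<bar> \<le> c"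
  shows "\<bar>LBINT v:A. f v\<bar> \<le> c * (t - s)"
proof -
  have [simp]: "A \<in> sets borel" and m: "measure lborel A = t - s" "emeasure lborel A < \<infinity>"
    using assms(1,2) by auto
  have "\<bar>LBINT v:A. f v\<bar> \<le> (LBINT v:A. c)"
    unfolding set_lebesgue_integral_def
  proof (rule integral_abs_bound[THEN order_trans], rule integral_mono)
    show "integrable lborel (\<lambda>v. \<bar>indicat_real A v *\<^sub>R f v\<bar>)"
      using assms(3) by (auto simp: set_integrable_def)
    show "integrable lborel (\<lambda>v. indicat_real A v *\<^sub>R c)"
      using m(2) by (intro integrable_scaleR_left integrable_real_indicator) auto
  qed (use assms(4) in \<open>auto simp: indicator_def\<close>)
  also have "\<dots> = c * (t - s)"
    using set_integral_const[of A lborel c] m by simp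
  finally show ?thesis .
qed

locale sine_drift = time_scale +
  fixes a :: real
  assumes a_less: "\<bar>a\<bar> < 1"
begin

section \<open>Jumps and the pathwise drift\<close>

definition jump :: "(real \<Rightarrow> real) \<Rightarrow> real \<Rightarrow> real" where
  "jump x s = x s - x (rho s)"

text \<open>The integrand of the equation pulled back along \<open>rho\<close>: at time
  \<open>v\<close> the sine sees the jump at \<open>rho v\<close>. On a gap it therefore depends
  only on the path up to the left end of that gap, which makes the drift predictable. The value 0
  outside [0,1] reflects that \<open>lambda_Delta\<close> comes from Lebesgue measure on
  [0,1].\<close>

definition force :: "(real \<Rightarrow> real) \<Rightarrow> real \<Rightarrow> real" where
  "force x v = (if v \<in> {0..1} then a * sin (jump x (rho v)) else 0)"

text \<open>\<open>\<lambda>\<^sub>\<Delta>\<close> is an image of Lebesgue measure, so the drift of the equation at time \<open>t \<in> T\<close> is a plain Lebesgue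
  integral over \<open>[0,t]\<close>: see \<open>lambda_Delta_integral\<close>.\<close>

definition drift :: "(real \<Rightarrow> real) \<Rightarrow> real \<Rightarrow> real" where
  "drift x t = (LBINT v:{0..t}. force x v)"

lemma jump_eq_0: "s \<in> T \<Longrightarrow> s \<notin> left_scattered \<Longrightarrow> jump x s = 0"
  using rho_le[of s] T_bounds(1)[of s] by (auto simp: left_scattered_def jump_def)

lemma jump_cong: "(\<And>s. s \<in> T \<Longrightarrow> x s = y s) \<Longrightarrow> s \<in> T \<Longrightarrow> jump x s = jump y s"
  using rho_mem T_bounds by (simp add: jump_def)

lemma force_cong: "(\<And>s. s \<in> T \<Longrightarrow> jump x s = jump y s) \<Longrightarrow> force x = force y"
  using rho_mem by (auto simp: force_def fun_eq_iff)

text \<open>Reduces the fixed point problem to the jumps: two solutions with the same jumps have the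
  same drift at all times.\<close>

lemma drift_cong: "(\<And>s. s \<in> T \<Longrightarrow> jump x s = jump y s) \<Longrightarrow> drift x = drift y"
  using force_cong[of x y] by (simp add: drift_def fun_eq_iff)

text \<open>Holds for an arbitrary function \<open>x\<close>, because the function vanishes off a
  countable set.\<close>

lemma sin_jump_measurable:
  "(\<lambda>s. if s \<in> left_scattered then a * sin (jump x s) else 0) \<in> borel_measurable borel"
  by (rule measurable_discrete_difference[OF _ countable_left_scattered, where f = "\<lambda>_. 0"]) auto

lemma rho_measurable: "rho \<in> borel_measurable (restrict_space borel {0..1})"
  by (rule borel_measurable_mono_on_fnc) (auto simp: mono_on_def intro: rho_mono)

lemma force_measurable [measurable]: "force x \<in> borel_measurable borel"
proof -
  let ?f = "\<lambda>s. if s \<in> left_scattered then a * sin (jump x s) else 0"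
  have "(\<lambda>v. ?f (rho v)) \<in> borel_measurable (restrict_space borel {0..1})"
    by (rule measurable_compose[OF rho_measurable sin_jump_measurable])
  then have "(\<lambda>v. if v \<in> {0..1} then ?f (rho v) else 0) \<in> borel_measurable borel"
    by (subst (asm) measurable_restrict_space_iff[of _ _ 0]) auto
  moreover have "(\<lambda>v. if v \<in> {0..1} then ?f (rho v) else 0) = force x"
    using jump_eq_0[OF rho_mem] by (auto simp: force_def fun_eq_iff)
  ultimately show ?thesis by simp
qed

lemma abs_force_le: "\<bar>force x v\<bar> \<le> \<bar>a\<bar>"
  by (auto simp: force_def abs_mult intro: mult_left_le)

lemma force_integrable: "set_integrable lborel {s..t} (force x)"
  unfolding set_integrable_def
  by (rule integrableI_bounded_set_indicator[where B = "\<bar>a\<bar>"])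
       (auto simp: abs_force_le emeasure_lborel_Icc_eq)

lemma force_integrable_half_open: "set_integrable lborel {s<..t} (force x)"
  by (rule set_integrable_subset[OF force_integrable[of s t x]]) auto

lemma drift_diff:
  assumes "0 \<le> s" "s \<le> t"
  shows "drift x t - drift x s = (LBINT v:{s<..t}. force x v)"
proof -
  have "{0..t} = {0..s} \<union> {s<..t}" using assms by auto
  then have "drift x t = drift x s + (LBINT v:{s<..t}. force x v)"
    unfolding drift_def
    using set_integral_Un[OF _ force_integrable[of 0 s x] force_integrable_half_open[of s t x]]
    by (simp add: disjoint_iff)
  then show ?thesis by simp
qed

lemma drift_0: "drift x 0 = 0"
  unfolding drift_def set_lebesgue_integral_def
  by (rule integral_eq_zero_AE, rule eventually_mono[OF AE_lborel_singleton[of 0]]) auto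

lemma drift_Lipschitz:
  assumes "0 \<le> s" "s \<le> t"
  shows "\<bar>drift x t - drift x s\<bar> \<le> \<bar>a\<bar> * (t - s)"
  unfolding drift_diff[OF assms]
  by (rule set_integral_abs_le[OF assms(2) _ force_integrable_half_open]) (auto intro: abs_force_le)

lemma integral_force_gap:
  assumes "r \<in> left_scattered"
  shows "(LBINT v:{rho r<..r}. force x v) = (r - rho r) * (a * sin (jump x (rho r)))"
proof -
  note r = left_scatteredD[OF assms]
  have "(LBINT v:{rho r<..r}. force x v) = (LBINT v:{rho r<..r}. a * sin (jump x (rho r)))"
  proof (rule set_lebesgue_integral_cong)
    have "force x v = a * sin (jump x (rho r))" if "rho r < v" "v \<le> r" for v
      using that r(4,5) by (simp add: force_def rho_const[OF assms that])
    then show "\<forall>v. v \<in> {rho r<..r} \<longrightarrow> force x v = a * sin (jump x (rho r))"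
      by simp
  qed auto
  then show ?thesis using r(2) by (simp add: set_integral_const)
qed

text \<open>\<open>rho\<close> is constant on the gap, so the integrand is too. The equation thus
  becomes an autoregression: each increment is driven by the one just before it.\<close>

lemma jump_drift:
  assumes "r \<in> left_scattered"
  shows "jump (drift x) r = (r - rho r) * (a * sin (jump x (rho r)))"
  using drift_diff[of "rho r" r x] left_scatteredD[OF assms] integral_force_gap[OF assms]
  by (simp add: jump_def)

lemma drift_diff_le:
  assumes "\<And>s. s \<in> T \<Longrightarrow> \<bar>jump x s - jump y s\<bar> \<le> e" "0 \<le> t" "t \<le> 1"
  shows "\<bar>drift x t - drift y t\<bar> \<le> \<bar>a\<bar> * e"
proof -
  have e: "0 \<le> e" using assms(1)[OF zero_mem] by linarith
  have *: "\<bar>force x v - force y v\<bar> \<le> \<bar>a\<bar> * e" for v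
    using order_trans[OF abs_sin_diff_le assms(1)[OF rho_mem[of v]]] e
    by (auto simp: force_def abs_mult right_diff_distrib[symmetric] intro!: mult_left_mono)
  have "drift x t - drift y t = (LBINT v:{0..t}. force x v - force y v)"
    unfolding drift_def by (rule set_integral_diff(2)[symmetric]; rule force_integrable)
  also have "\<bar>\<dots>\<bar> \<le> (\<bar>a\<bar> * e) * (t - 0)"
    by (rule set_integral_abs_le) (use assms * force_integrable in auto)
  also have "\<dots> \<le> \<bar>a\<bar> * e" using assms e by (simp add: mult_left_le)
  finally show ?thesis .
qed

text \<open>The driving path cancels. Across a gap the three factors are the length, at most 1, the
  constant \<bar>a\<bar>, and the Lipschitz constant 1 of the sine; away from gaps all jumps
  vanish.\<close>

lemma jump_drift_contraction:
  assumes "\<And>s. s \<in> T \<Longrightarrow> \<bar>jump x s - jump y s\<bar> \<le> e" "s \<in> T"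
  shows "\<bar>jump (\<lambda>t. w t + drift x t) s - jump (\<lambda>t. w t + drift y t) s\<bar> \<le> \<bar>a\<bar> * e"
proof -
  have e: "0 \<le> e" using assms(1)[OF zero_mem] by linarith
  have "jump (\<lambda>t. w t + drift x t) s - jump (\<lambda>t. w t + drift y t) s = jump (drift x) s - jump (drift y) s"
    by (simp add: jump_def)
  also have "\<bar>\<dots>\<bar> \<le> \<bar>a\<bar> * e"
  proof (cases "s \<in> left_scattered")
    case True
    note s = left_scatteredD[OF True]
    have "jump (drift x) s - jump (drift y) s = (s - rho s) * (a * (sin (jump x (rho s)) - sin (jump y (rho s))))"
      by (simp add: jump_drift[OF True] algebra_simps)
    also have "\<bar>\<dots>\<bar> \<le> 1 * (\<bar>a\<bar> * e)"
      unfolding abs_mult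
      using order_trans[OF abs_sin_diff_le assms(1)[OF s(3)]] s e
      by (intro mult_mono) auto
    finally show ?thesis by simp
  qed (use e assms jump_eq_0 in auto)
  finally show ?thesis .
qed

text \<open>The bound is uniform in \<open>x\<close>, so the contraction can start from a fixed
  constant whatever the driving path is.\<close>

lemma abs_jump_drift_le: "s \<in> T \<Longrightarrow> \<bar>jump (drift x) s\<bar> \<le> 1"
proof (cases "s \<in> left_scattered")
  case True
  note s = left_scatteredD[OF True]
  have "\<bar>(s - rho s) * (a * sin (jump x (rho s)))\<bar> \<le> 1 * (1 * 1)"
    unfolding abs_mult using s a_less by (intro mult_mono) auto
  then show ?thesis by (simp add: jump_drift[OF True])
qed (use jump_eq_0 in auto)

section \<open>Picard iteration for a fixed driving path\<close>

primrec picard :: "(real \<Rightarrow> real) \<Rightarrow> nat \<Rightarrow> real \<Rightarrow> real" where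
  "picard w 0 = w"
| "picard w (Suc n) = (\<lambda>t. w t + drift (picard w n) t)"

text \<open>Elements of the path space are extensional on \<open>T\<close>, hence the
  restriction.\<close>

definition solution :: "(real \<Rightarrow> real) \<Rightarrow> real \<Rightarrow> real" where
  "solution w = restrict (\<lambda>t. lim (\<lambda>n. picard w n t)) T"

text \<open>The first two iterates after \<open>w\<close> differ by two drifts, each with jumps of
  size at most 1; this is the constant 2. Each further step gains a factor \<bar>a\<bar>.\<close>

lemma picard_jump_le:
  "s \<in> T \<Longrightarrow> \<bar>jump (picard w (Suc (Suc n))) s - jump (picard w (Suc n)) s\<bar> \<le> \<bar>a\<bar> ^ n * 2"
proof (induction n arbitrary: s)
  case 0
  then show ?case
    using abs_jump_drift_le[of s "picard w (Suc 0)"] abs_jump_drift_le[of s "picard w 0"]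
    by (simp add: jump_def)
next
  case (Suc n)
  then show ?case
    using jump_drift_contraction[OF Suc.IH, of s w] by simp
qed

lemma picard_convergent:
  assumes "t \<in> T" shows "convergent (\<lambda>n. picard w n t)"
proof -
  \<comment> \<open>The shift by 2 comes from \<open>picard_jump_le\<close>: it compares iterates
    \<open>n + 2\<close> and \<open>n + 1\<close>, and one more application of the drift turns its
    bound on jumps into a bound on values.\<close>
  have "summable (\<lambda>n. picard w (Suc (n + 2)) t - picard w (n + 2) t)"
  proof (rule summable_comparison_test')
    show "summable (\<lambda>n. \<bar>a\<bar> ^ n * (\<bar>a\<bar> * 2))"
      using a_less by (intro summable_mult2 summable_geometric) auto
    fix n
    have "picard w (Suc (n + 2)) t - picard w (n + 2) t
        = drift (picard w (Suc (Suc n))) t - drift (picard w (Suc n)) t"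
      by simp
    also have "\<bar>\<dots>\<bar> \<le> \<bar>a\<bar> * (\<bar>a\<bar> ^ n * 2)"
      by (rule drift_diff_le[OF picard_jump_le]) (use T_bounds assms in auto)
    finally show "norm (picard w (Suc (n + 2)) t - picard w (n + 2) t) \<le> \<bar>a\<bar> ^ n * (\<bar>a\<bar> * 2)"
      by (simp only: real_norm_def mult_ac)
  qed
  then have "convergent (\<lambda>m. picard w (m + 2) t - picard w (0 + 2) t)"
    using sum_lessThan_telescope[of "\<lambda>n. picard w (n + 2) t"]
    by (simp only: summable_iff_convergent add_Suc)
  then have "convergent (\<lambda>n. picard w (n + 2) t)"
    by (simp only: convergent_diff_const_right_iff)
  then show ?thesis using convergent_ignore_initial_segment[of "\<lambda>n. picard w n t" 2] by simp
qed

lemma picard_tendsto: "t \<in> T \<Longrightarrow> (\<lambda>n. picard w n t) \<longlonglongrightarrow> solution w t"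
  using picard_convergent by (simp add: solution_def convergent_LIMSEQ_iff)

text \<open>Convergence on \<open>T\<close> suffices, since the integrand evaluates the path only at
  \<open>rho v\<close> and \<open>rho (rho v)\<close>; dominated convergence does the rest.\<close>

lemma drift_tendsto:
  assumes "\<And>t. t \<in> T \<Longrightarrow> (\<lambda>n. x n t) \<longlonglongrightarrow> y t"
  shows "(\<lambda>n. drift (x n) t) \<longlonglongrightarrow> drift y t"
  unfolding drift_def set_lebesgue_integral_def
proof (rule integral_dominated_convergence)
  show "integrable lborel (\<lambda>v. indicat_real {0..t} v * \<bar>a\<bar>)"
    by (intro integrable_mult_left integrable_real_indicator) (auto simp: emeasure_lborel_Icc_eq)
  have "(\<lambda>n. force (x n) v) \<longlonglongrightarrow> force y v" for v
    using assms[OF rho_mem[of v]] assms[OF rho_mem[OF rho_nonneg[of v]]]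
    by (auto simp: force_def jump_def intro!: tendsto_intros)
  then show "AE v in lborel. (\<lambda>n. indicat_real {0..t} v *\<^sub>R force (x n) v) \<longlonglongrightarrow> indicat_real {0..t} v *\<^sub>R force y v"
    by (intro AE_I2 tendsto_intros)
qed (auto simp: abs_force_le indicator_def)

lemma solution_eq:
  assumes "t \<in> T" shows "solution w t = w t + drift (solution w) t"
proof (rule LIMSEQ_unique)
  show "(\<lambda>n. picard w (Suc n) t) \<longlonglongrightarrow> solution w t"
    using picard_tendsto[OF assms] by (rule LIMSEQ_Suc)
  show "(\<lambda>n. picard w (Suc n) t) \<longlonglongrightarrow> w t + drift (solution w) t"
    by (auto intro!: tendsto_intros drift_tendsto picard_tendsto)
qed

text \<open>Both solutions are fixed by the iteration, so the contraction applies to their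
  difference any number of times and forces equal jumps; then \<open>drift_cong\<close>
  applies.\<close>

lemma drift_eq_unique:
  assumes x: "\<And>t. t \<in> T \<Longrightarrow> x t = w t + drift x t" and y: "\<And>t. t \<in> T \<Longrightarrow> y t = w t + drift y t"
    and t: "t \<in> T"
  shows "x t = y t"
proof -
  have jx: "jump x s = jump (\<lambda>t. w t + drift x t) s" and jy: "jump y s = jump (\<lambda>t. w t + drift y t) s"
    if "s \<in> T" for s
    by (rule jump_cong[OF _ that]; fact)+
  have le: "\<bar>jump x s - jump y s\<bar> \<le> \<bar>a\<bar> ^ n * 2" if "s \<in> T" for n s
    using that
  proof (induction n arbitrary: s)
    case 0
    then show ?case
      using abs_jump_drift_le[of s x] abs_jump_drift_le[of s y] jx[of s] jy[of s]
      by (simp add: jump_def)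
  next
    case (Suc n)
    then show ?case
      using jump_drift_contraction[OF Suc.IH, of s w] jx jy by simp
  qed
  have lim: "(\<lambda>n. \<bar>a\<bar> ^ n * 2) \<longlonglongrightarrow> 0"
    using tendsto_mult_left_zero[OF LIMSEQ_realpow_zero[of "\<bar>a\<bar>"], of 2] a_less by simp
  have "jump x s = jump y s" if "s \<in> T" for s
  proof -
    have "\<bar>jump x s - jump y s\<bar> \<le> 0"
      by (rule LIMSEQ_le_const[OF lim]) (use le[OF that] in auto)
    then show ?thesis by simp
  qed
  then have "drift x = drift y" by (rule drift_cong)
  then show ?thesis using x y t by simp
qed

section \<open>The inverse map and its truncation to finitely many gaps\<close>

definition unshift :: "(real \<Rightarrow> real) \<Rightarrow> real \<Rightarrow> real" where
  "unshift x = restrict (\<lambda>t. x t - drift x t) T"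

text \<open>\<open>x\<close> itself solves the equation driven by \<open>unshift x\<close>, so
  uniqueness identifies it.\<close>

lemma solution_unshift:
  assumes "t \<in> T" shows "solution (unshift x) t = x t"
  by (rule drift_eq_unique[where w = "unshift x", OF solution_eq _ assms]) (auto simp: unshift_def)

definition gap_drift :: "real set \<Rightarrow> (real \<Rightarrow> real) \<Rightarrow> real \<Rightarrow> real" where
  "gap_drift K x t = (\<Sum>r\<in>{r \<in> K. r \<le> t}. a * sin (jump x (rho r)) * (r - rho r))"

lemma gap_drift_eq_integral:
  assumes "finite K" "K \<subseteq> left_scattered"
  shows "gap_drift K x t = (LBINT v:(\<Union>r\<in>{r \<in> K. r \<le> t}. {rho r<..r}). force x v)"
proof -
  have disj: "disjoint_family_on (\<lambda>r. {rho r<..r}) {r \<in> K. r \<le> t}"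
    using assms(2) gaps_disjoint unfolding disjoint_family_on_def by blast
  have "(LBINT v:(\<Union>r\<in>{r \<in> K. r \<le> t}. {rho r<..r}). force x v)
      = (\<Sum>r\<in>{r \<in> K. r \<le> t}. LBINT v:{rho r<..r}. force x v)"
    by (rule set_integral_finite_Union)
       (use assms disj force_integrable_half_open in auto)
  also have "\<dots> = gap_drift K x t"
    unfolding gap_drift_def using assms by (intro sum.cong) (auto simp: integral_force_gap mult_ac)
  finally show ?thesis by simp
qed

text \<open>The integrand vanishes wherever \<open>rho v = v\<close>, and every other
  \<open>v\<close> lies in a gap that some \<open>K n\<close> eventually contains for good. A gap
  meeting [0,t] ends by time \<open>t\<close>, because \<open>t\<close> lies in
  \<open>T\<close>.\<close>

lemma gap_drift_tendsto:
  assumes K: "\<And>n. finite (K n)" "\<And>n. K n \<subseteq> left_scattered" "\<And>r. r \<in> left_scattered \<Longrightarrow> \<forall>\<^sub>F n in sequentially. r \<in> K n"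
    and t: "t \<in> T"
  shows "(\<lambda>n. gap_drift (K n) x t) \<longlonglongrightarrow> drift x t"
  unfolding gap_drift_eq_integral[OF K(1,2)] drift_def set_lebesgue_integral_def
proof (rule integral_dominated_convergence)
  let ?U = "\<lambda>n. \<Union>r\<in>{r \<in> K n. r \<le> t}. {rho r<..r}"
  have U: "?U n \<subseteq> {0..t}" for n
    using K(2)[of n] left_scatteredD(4) by fastforce
  show "integrable lborel (\<lambda>v. indicat_real {0..t} v * \<bar>a\<bar>)"
    by (intro integrable_mult_left integrable_real_indicator) (auto simp: emeasure_lborel_Icc_eq)
  show "(\<lambda>v. indicat_real (?U n) v *\<^sub>R force x v) \<in> borel_measurable lborel" for n
  proof -
    have "?U n \<in> sets borel" using K(1)[of n] by (intro sets.finite_UN) auto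
    then show ?thesis by simp
  qed
  show "AE v in lborel. norm (indicat_real (?U n) v *\<^sub>R force x v) \<le> indicat_real {0..t} v * \<bar>a\<bar>" for n
  proof (rule AE_I2)
    fix v
    have "indicat_real (?U n) v \<le> indicat_real {0..t} v" by (rule indicator_leI) (rule subsetD[OF U])
    then show "norm (indicat_real (?U n) v *\<^sub>R force x v) \<le> indicat_real {0..t} v * \<bar>a\<bar>"
      unfolding real_norm_def real_scaleR_def abs_mult abs_of_nonneg[OF indicator_pos_le]
      by (intro mult_mono abs_force_le) auto
  qed
  have "\<forall>\<^sub>F n in sequentially. indicat_real (?U n) v *\<^sub>R force x v = indicat_real {0..t} v *\<^sub>R force x v" for v
  proof (cases "v \<in> {0..t} \<and> force x v \<noteq> 0")
    case True
    then have v: "0 \<le> v" "v \<le> 1" "v \<le> t" and "jump x (rho v) \<noteq> 0" by (auto simp: force_def split: if_splits)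
    then have "rho v \<noteq> v" by (auto simp: jump_def)
    then have "rho v < v" using rho_le[OF v(1)] by simp
    from gap_cover[OF v(1,2) this] obtain r where r: "r \<in> left_scattered" "rho r < v" "v \<le> r" by metis
    have "r \<le> t" using left_scattered_le_iff[OF r(1) t] r v by simp
    show ?thesis
      using K(3)[OF r(1)]
    proof (rule eventually_mono)
      fix n assume "r \<in> K n"
      then have "v \<in> ?U n" using r \<open>r \<le> t\<close> by auto
      then show "indicat_real (?U n) v *\<^sub>R force x v = indicat_real {0..t} v *\<^sub>R force x v"
        using v by simp
    qed
  next
    case False
    have "indicat_real (?U n) v *\<^sub>R force x v = indicat_real {0..t} v *\<^sub>R force x v" for n
    proof (cases "force x v = 0")
      case nonzero: False
      with False have 1: "v \<notin> {0..t}" by simp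
      then have 2: "v \<notin> ?U n" using subsetD[OF U] by blast
      show ?thesis by (simp only: indicator_simps(2)[OF 1] indicator_simps(2)[OF 2])
    qed simp
    then show ?thesis by simp
  qed
  then show "AE v in lborel. (\<lambda>n. indicat_real (?U n) v *\<^sub>R force x v) \<longlonglongrightarrow> indicat_real {0..t} v *\<^sub>R force x v"
    by (intro AE_I2 tendsto_eventually)
qed simp

lemma left_scattered_exhaustion:
  obtains K :: "nat \<Rightarrow> real set" where "\<And>n. finite (K n)" "\<And>n. K n \<subseteq> left_scattered"
    "\<And>r. r \<in> left_scattered \<Longrightarrow> \<forall>\<^sub>F n in sequentially. r \<in> K n"
proof (cases "left_scattered = {}")
  case True
  then show ?thesis by (intro that[of "\<lambda>_. {}"]) auto
next
  case False
  define f where "f = from_nat_into left_scattered"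
  have f: "range f = left_scattered"
    unfolding f_def using False countable_left_scattered by (rule range_from_nat_into)
  show ?thesis
  proof (rule that[of "\<lambda>n. f ` {..n}"])
    fix r assume "r \<in> left_scattered"
    then obtain m where "r = f m" using f by auto
    then show "\<forall>\<^sub>F n in sequentially. r \<in> f ` {..n}"
      by (intro eventually_sequentiallyI[of m]) auto
  qed (use f in auto)
qed

text \<open>Change of variables along \<open>rho\<close>. For \<open>v \<noteq> t\<close>, the
  condition \<open>rho v < t\<close> is the same as \<open>v \<le> t\<close>, so the half-open
  interval in \<open>s\<close> pulls back to the closed interval in \<open>v\<close> up to a
  Lebesgue null set.\<close>

lemma lambda_Delta_integral:
  assumes t: "t \<in> T"
  shows "set_integrable (lambda_Delta T) ({0..<t} \<inter> T) (\<lambda>s. a * sin (x s - x (backward_jump T s)))" (is ?int)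
    and "(LINT s:{0..<t} \<inter> T|lambda_Delta T. a * sin (x s - x (backward_jump T s))) = drift x t" (is ?eq)
proof -
  let ?g = "\<lambda>s. indicat_real ({0..<t} \<inter> T) s *\<^sub>R (a * sin (x s - x (backward_jump T s)))"
  let ?f = "\<lambda>s. if s \<in> left_scattered then a * sin (jump x s) else 0"
  have f_eq: "?f s = a * sin (jump x s)" if "s \<in> T" for s
    using jump_eq_0[OF that] by simp
  have g_eq: "?g s = indicat_real {0..<t} s *\<^sub>R (a * sin (jump x s))" if "s \<in> T" for s
    using that by (simp add: indicator_def backward_jump_def jump_def)
  have "(\<lambda>s. indicat_real {0..<t} s *\<^sub>R ?f s) \<in> borel_measurable borel"
    using sin_jump_measurable by measurable
  then have "(\<lambda>s. indicat_real {0..<t} s *\<^sub>R ?f s) \<in> borel_measurable (restrict_space borel T)"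
    by (rule measurable_restrict_space1)
  then have g: "?g \<in> borel_measurable (restrict_space borel T)"
    by (rule measurable_cong[THEN iffD1, rotated]) (simp only: space_restrict_space space_borel Int_UNIV_right g_eq f_eq)
  have rho: "rho \<in> restrict_space lborel {0..1} \<rightarrow>\<^sub>M restrict_space borel T"
    using rho_measurable by (intro measurable_restrict_space2)
      (auto simp: space_restrict_space intro: rho_mem cong: measurable_cong_sets
        simp: sets_restrict_space)
  have ae: "AE v in lborel. indicat_real {0..1} v *\<^sub>R ?g (rho v) = indicat_real {0..t} v *\<^sub>R force x v"
  proof (rule eventually_mono[OF AE_lborel_singleton[of t]])
    fix v assume "v \<noteq> t"
    show "indicat_real {0..1} v *\<^sub>R ?g (rho v) = indicat_real {0..t} v *\<^sub>R force x v"
    proof (cases "v \<in> {0..1}")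
      case True
      then have "rho v < t \<longleftrightarrow> v \<le> t"
        using rho_le[of v] rho_upper[OF t, of v] \<open>v \<noteq> t\<close> by (cases "v < t") auto
      with True show ?thesis
        using g_eq[OF rho_mem[of v]] rho_nonneg[of v] by (auto simp: force_def indicator_def)
    qed (auto simp: indicator_def force_def)
  qed
  have meas: "(\<lambda>v. indicat_real {0..1} v *\<^sub>R ?g (rho v)) \<in> borel_measurable lborel"
    using measurable_compose[OF rho g] by (subst (asm) borel_measurable_restrict_space_iff) auto
  have "integrable lborel (\<lambda>v. indicat_real {0..1} v *\<^sub>R ?g (rho v))"
    using integrable_cong_AE[OF meas _ ae] force_integrable[of 0 t x] by (simp add: set_integrable_def)
  then show ?int
    unfolding set_integrable_def lambda_Delta_def
    by (subst integrable_distr_eq[OF rho g]) (simp add: integrable_restrict_space)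
  show ?eq
    unfolding set_lebesgue_integral_def lambda_Delta_def drift_def
    by (subst integral_distr[OF rho g])
      (use integral_cong_AE[OF meas _ ae] in \<open>simp add: integral_restrict_space\<close>)
qed

lemma sine_equation_iff:
  "sine_equation T a x w \<longleftrightarrow> (\<forall>t\<in>T. x t = w t + drift x t)"
  using lambda_Delta_integral by (auto simp: sine_equation_def)

end

subsection \<open>Borel sets of the path space\<close>

context time_scale
begin

abbreviation paths :: "(real \<Rightarrow> real) set" where
  "paths \<equiv> mspace (path_space T)"

lemma paths_iff: "w \<in> paths \<longleftrightarrow> w \<in> extensional T \<and> continuous_on T w \<and> w 0 = 0"
proof -
  have "compactin (top_of_set T) (topspace (top_of_set T))"
    using compact_T by (simp add: compactin_subtopology)
  from compactin_mspace_cfunspace[OF this, of "euclidean_metric :: real metric"] show ?thesis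
    by (auto simp: path_space_def mtopology_of_euclidean)
qed

lemma openin_path_spaceD:
  assumes "openin (mtopology_of (path_space T)) U" "w \<in> U"
  obtains e where "0 < e" "\<And>v. v \<in> paths \<Longrightarrow> (\<And>t. t \<in> T \<Longrightarrow> \<bar>v t - w t\<bar> \<le> e) \<Longrightarrow> v \<in> U"
proof -
  interpret Metric_space paths "mdist (path_space T)" by (rule Metric_space_mspace_mdist)
  obtain r where r: "0 < r" "mball w r \<subseteq> U" and w: "w \<in> paths"
    using assms unfolding mtopology_of_def openin_mtopology by blast
  show ?thesis
  proof
    \<comment> \<open>Half the radius, since uniform closeness only gives a non-strict bound on the
      distance while the ball is open.\<close>
    show "0 < r / 2" using r by simp
    fix v assume v: "v \<in> paths" "\<And>t. t \<in> T \<Longrightarrow> \<bar>v t - w t\<bar> \<le> r / 2"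
    have "mdist (path_space T) w v \<le> r / 2"
      unfolding path_space_def mdist_submetric
      by (rule mdist_cfunspace_le) (use r v in \<open>auto simp: dist_real_def abs_minus_commute\<close>)
    then have "v \<in> mball w r" using r v w by simp
    then show "v \<in> U" using r by auto
  qed
qed

lemma space_path_borel [simp]: "space (path_borel T) = paths"
  by (simp add: path_borel_def space_measure_of_conv)

lemma space_path_filtration [simp]: "space (path_filtration T t) = paths"
  by (simp add: path_filtration_def space_measure_of_conv)

lemma open_sets_path_borel:
  assumes "openin (mtopology_of (path_space T)) U" shows "U \<in> sets (path_borel T)"
proof -
  have "U \<subseteq> paths" if "openin (mtopology_of (path_space T)) U" for U
    using openin_subset[OF that] by simp
  then show ?thesis
    unfolding path_borel_def using assms by (subst sets_measure_of) auto
qed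

lemma sets_path_filtration:
  "sets (path_filtration T t) = sigma_sets paths {{\<omega> \<in> paths. \<omega> s \<in> U} | s U. s \<in> {0..t} \<inter> T \<and> U \<in> sets borel}"
  unfolding path_filtration_def by (subst sets_measure_of) auto

lemma measurable_eval:
  assumes "s \<in> T" "s \<le> t" shows "(\<lambda>w. w s) \<in> borel_measurable (path_filtration T t)"
proof (rule measurableI)
  fix U :: "real set" assume "U \<in> sets borel"
  have "{\<omega> \<in> paths. \<omega> s \<in> U} \<in> sets (path_filtration T t)"
    unfolding sets_path_filtration
    by (rule sigma_sets.Basic) (use assms T_bounds \<open>U \<in> sets borel\<close> in auto)
  moreover have "(\<lambda>w. w s) -` U \<inter> space (path_filtration T t) = {\<omega> \<in> paths. \<omega> s \<in> U}" by auto
  ultimately show "(\<lambda>w. w s) -` U \<inter> space (path_filtration T t) \<in> sets (path_filtration T t)" by simp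
qed simp

lemma measurable_path_filtration:
  assumes "\<And>\<omega>. \<omega> \<in> space M \<Longrightarrow> F \<omega> \<in> paths"
    and "\<And>s. s \<in> T \<Longrightarrow> s \<le> t \<Longrightarrow> (\<lambda>\<omega>. F \<omega> s) \<in> borel_measurable M"
  shows "F \<in> M \<rightarrow>\<^sub>M path_filtration T t"
  unfolding path_filtration_def
proof (rule measurable_sigma_sets[OF sets_measure_of])
  fix A assume "A \<in> {{\<omega> \<in> paths. \<omega> s \<in> U} | s U. s \<in> {0..t} \<inter> T \<and> U \<in> sets borel}"
  then obtain s U where sU: "A = {\<omega> \<in> paths. \<omega> s \<in> U}" "s \<in> T" "s \<le> t" "U \<in> sets borel" by auto
  then have "F -` A \<inter> space M = (\<lambda>\<omega>. F \<omega> s) -` U \<inter> space M" using assms(1) by auto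
  then show "F -` A \<inter> space M \<in> sets M" using measurable_sets[OF assms(2)] sU by simp
qed (use assms(1) in auto)

lemma eval_path_borel:
  assumes s: "s \<in> T" shows "(\<lambda>w. w s) \<in> borel_measurable (path_borel T)"
proof (rule borel_measurableI)
  fix U :: "real set" assume U: "open U"
  interpret Metric_space paths "mdist (path_space T)" by (rule Metric_space_mspace_mdist)
  have "openin (mtopology_of (path_space T)) {w \<in> paths. w s \<in> U}"
    unfolding mtopology_of_def openin_mtopology
  proof (intro conjI allI impI)
    fix w assume "w \<in> {w \<in> paths. w s \<in> U}"
    then have w: "w \<in> paths" "w s \<in> U" by auto
    obtain e where e: "0 < e" "ball (w s) e \<subseteq> U" using U w(2) open_contains_ball by blast
    have "v s \<in> U" if "v \<in> mball w e" for v
    proof -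
      have v: "v \<in> paths" "mdist (path_space T) w v < e" using that by auto
      then have "dist (w s) (v s) \<le> mdist (path_space T) w v"
        using mdist_cfunspace_imp_mdist_le[of w "top_of_set T" euclidean_metric v _ s] w s
        by (simp add: path_space_def mdist_submetric)
      with v e show ?thesis by auto
    qed
    then show "\<exists>r>0. mball w r \<subseteq> {w \<in> paths. w s \<in> U}" using e by (intro exI[of _ e]) auto
  qed auto
  from open_sets_path_borel[OF this]
  show "(\<lambda>w. w s) -` U \<inter> space (path_borel T) \<in> sets (path_borel T)"
    by (simp add: vimage_def Int_def conj_commute)
qed

section \<open>Countably many coordinates determine the Borel sets\<close>

definition dense_seq :: "nat \<Rightarrow> real" where
  "dense_seq = from_nat_into (SOME D. countable D \<and> D \<subseteq> T \<and> T \<subseteq> closure D)"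

lemma dense_seq: "dense_seq n \<in> T" "T \<subseteq> closure (range dense_seq)"
proof -
  let ?D = "SOME D. countable D \<and> D \<subseteq> T \<and> T \<subseteq> closure D"
  have "\<exists>D. countable D \<and> D \<subseteq> T \<and> T \<subseteq> closure D"
    using separable[of T] by metis
  from someI_ex[OF this] have D: "countable ?D" "?D \<subseteq> T" "T \<subseteq> closure ?D" by auto
  have "?D \<noteq> {}" using D(3) zero_mem by auto
  then have "range dense_seq = ?D" unfolding dense_seq_def using D(1) by (rule range_from_nat_into)
  then show "dense_seq n \<in> T" "T \<subseteq> closure (range dense_seq)" using D by auto
qed

lemma dense_seq_approx:
  fixes w :: "real \<Rightarrow> real"
  assumes "continuous_on T w" "t \<in> T" "open J" "t \<in> J" "0 < e"
  obtains k where "dense_seq k \<in> J" "\<bar>w (dense_seq k) - w t\<bar> < e"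
proof -
  obtain \<delta> where \<delta>: "0 < \<delta>" "\<And>s. s \<in> T \<Longrightarrow> dist s t < \<delta> \<Longrightarrow> dist (w s) (w t) < e"
    using assms unfolding continuous_on_iff by blast
  have "open (J \<inter> ball t \<delta>)" "t \<in> J \<inter> ball t \<delta>" using assms \<delta> by auto
  moreover have "t \<in> closure (range dense_seq)" using dense_seq(2) assms by auto
  ultimately obtain s where "s \<in> range dense_seq" "s \<in> J \<inter> ball t \<delta>"
    using open_Int_closure_eq_empty[of "J \<inter> ball t \<delta>" "range dense_seq"] by blast
  then show ?thesis using that \<delta>(2)[of s] dense_seq(1) by (auto simp: dist_real_def dist_commute)
qed

definition coords :: "(real \<Rightarrow> real) \<Rightarrow> nat \<Rightarrow> real" where
  "coords w k = w (dense_seq k)"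

text \<open>Every open set of paths is a union of tubes, and there are only countably many tubes: hence the
  Borel sets of the path space are determined by the coordinates at \<open>dense_seq\<close>.\<close>

definition tube :: "(rat \<times> rat \<times> rat) list \<Rightarrow> nat \<Rightarrow> (nat \<Rightarrow> real) set" where
  "tube ps j = {y. \<forall>k. \<forall>(p, q, v) \<in> set ps. of_rat p < dense_seq k \<longrightarrow> dense_seq k < of_rat q \<longrightarrow>
     \<bar>y k - of_rat v\<bar> \<le> 1 / (real j + 1)}"

lemma tube_measurable: "tube ps j \<in> sets borel"
proof -
  have "tube ps j = (\<Inter>(k, p, q, v) \<in> {(k, p, q, v). (p, q, v) \<in> set ps \<and> of_rat p < dense_seq k \<and> dense_seq k < of_rat q}.
      {y. \<bar>y k - of_rat v\<bar> \<le> 1 / (real j + 1)})"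
    unfolding tube_def by auto
  moreover have "closed {y :: nat \<Rightarrow> real. \<bar>y k - of_rat v\<bar> \<le> 1 / (real j + 1)}" for k v
    by (intro closed_Collect_le continuous_intros continuous_on_product_coordinates)
  ultimately have "closed (tube ps j)" by (auto intro!: closed_INT)
  then show ?thesis by simp
qed

text \<open>By continuity both paths stay within \<open>1 / (real j + 1)\<close> of the same
  rational value at \<open>t\<close>, as they do at the dense times close to
  \<open>t\<close>.\<close>

lemma tube_diameter:
  assumes cover: "\<And>t. t \<in> T \<Longrightarrow> \<exists>(p, q, v) \<in> set ps. of_rat p < t \<and> t < of_rat q"
    and w: "continuous_on T w" "coords w \<in> tube ps j" and w': "continuous_on T w'" "coords w' \<in> tube ps j" and t: "t \<in> T"
  shows "\<bar>w t - w' t\<bar> \<le> 2 / (real j + 1)"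
proof -
  obtain p q v where pq: "(p, q, v) \<in> set ps" "of_rat p < t" "t < of_rat q" using cover[OF t] by auto
  have close: "\<bar>x t - of_rat v\<bar> \<le> 1 / (real j + 1)" if x: "continuous_on T x" "coords x \<in> tube ps j" for x
  proof (rule field_le_epsilon)
    fix e :: real assume "0 < e"
    obtain k where k: "dense_seq k \<in> {of_rat p<..<of_rat q}" "\<bar>x (dense_seq k) - x t\<bar> < e"
      using dense_seq_approx[OF x(1) t _ _ \<open>0 < e\<close>, of "{of_rat p<..<of_rat q}"] pq by auto
    have "\<bar>x (dense_seq k) - of_rat v\<bar> \<le> 1 / (real j + 1)"
      using x(2) pq(1) k(1) by (fastforce simp: tube_def coords_def)
    with k(2) show "\<bar>x t - of_rat v\<bar> \<le> 1 / (real j + 1) + e" by linarith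
  qed
  have "2 / (real j + 1) = 1 / (real j + 1) + 1 / (real j + 1)" by simp
  with close[OF w] close[OF w'] show ?thesis by linarith
qed

text \<open>Uses compactness of \<open>T\<close>: finitely many rational intervals, on each of which
  \<open>w\<close> is nearly constant, cover it.\<close>

lemma tube_exists:
  assumes w: "continuous_on T w"
  obtains ps where "coords w \<in> tube ps j" "\<And>t. t \<in> T \<Longrightarrow> \<exists>(p, q, v) \<in> set ps. of_rat p < t \<and> t < of_rat q"
proof -
  define c where "c = 1 / (real j + 1)"
  let ?ok = "\<lambda>(p, q, v). \<forall>s\<in>T. of_rat p < s \<longrightarrow> s < of_rat q \<longrightarrow> \<bar>w s - of_rat v\<bar> \<le> c"
  let ?I = "\<lambda>(p :: rat, q :: rat, v :: rat). {of_rat p<..<of_rat q :: real}"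
  have pos: "0 < c" by (simp add: c_def)
  have ex: "\<exists>z. ?ok z \<and> t \<in> ?I z" if t: "t \<in> T" for t
  proof -
    \<comment> \<open>One half of \<open>c\<close> is for the oscillation of \<open>w\<close>, the
      other for replacing \<open>w t\<close> by a rational number.\<close>
    obtain \<delta> where \<delta>: "0 < \<delta>" "\<And>s. s \<in> T \<Longrightarrow> dist s t < \<delta> \<Longrightarrow> dist (w s) (w t) < c / 2"
      using w t pos unfolding continuous_on_iff by (metis half_gt_zero)
    obtain p where p: "t - \<delta> < of_rat p" "of_rat p < t" using of_rat_dense[of "t - \<delta>" t] \<delta> by auto
    obtain q where q: "t < of_rat q" "of_rat q < t + \<delta>" using of_rat_dense[of t "t + \<delta>"] \<delta> by auto
    obtain v where v: "w t < of_rat v" "of_rat v < w t + c / 2"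
      using of_rat_dense[of "w t" "w t + c / 2"] pos by auto
    have "?ok (p, q, v)"
    proof (clarify)
      fix s assume "s \<in> T" "of_rat p < s" "s < of_rat q"
      then have "dist (w s) (w t) < c / 2" using p q by (intro \<delta>) (auto simp: dist_real_def)
      then show "\<bar>w s - of_rat v\<bar> \<le> c" using v unfolding dist_real_def by linarith
    qed
    then show ?thesis using p q by (intro exI[of _ "(p, q, v)"]) auto
  qed
  have "T \<subseteq> \<Union>(?I ` Collect ?ok)" using ex by blast
  moreover have "\<And>S. S \<in> ?I ` Collect ?ok \<Longrightarrow> open S" by auto
  ultimately obtain C where C: "C \<subseteq> ?I ` Collect ?ok" "finite C" "T \<subseteq> \<Union>C"
    by (rule compactE[OF compact_T])
  obtain Z where Z: "Z \<subseteq> Collect ?ok" "finite Z" "C = ?I ` Z"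
    using finite_subset_image[OF C(2,1)] by blast
  obtain ps where ps: "set ps = Z" using finite_list[OF Z(2)] by blast
  show ?thesis
  proof (rule that[of ps])
    show "coords w \<in> tube ps j"
      unfolding tube_def coords_def c_def[symmetric]
    proof clarify
      fix k p q v assume *: "(p, q, v) \<in> set ps" "of_rat p < dense_seq k" "dense_seq k < of_rat q"
      then have "?ok (p, q, v)" using Z(1) unfolding ps by blast
      then show "\<bar>w (dense_seq k) - of_rat v\<bar> \<le> c" using * dense_seq(1) by simp
    qed
    show "\<exists>(p, q, v) \<in> set ps. of_rat p < t \<and> t < of_rat q" if t: "t \<in> T" for t
    proof -
      obtain z where "z \<in> Z" "t \<in> ?I z" using C(3) Z(3) t by blast
      then show ?thesis using ps by (cases z) auto
    qed
  qed
qed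

lemma path_borel_coords:
  assumes "A \<in> sets (path_borel T)"
  obtains A' where "A' \<in> sets borel" "A = {w \<in> paths. coords w \<in> A'}"
proof -
  have "\<exists>A'\<in>sets borel. A = {w \<in> paths. coords w \<in> A'}"
    if "A \<in> sigma_sets paths {U. openin (mtopology_of (path_space T)) U}" for A
    using that
  proof (induction rule: sigma_sets.induct)
    case (Basic U)
    then have U: "openin (mtopology_of (path_space T)) U" by simp
    \<comment> \<open>All tubes whose paths lie in \<open>U\<close>. The indices are pairs of a list
      of rational triples and a natural number, so there are countably many.\<close>
    let ?S = "{(ps, j). {w \<in> paths. coords w \<in> tube ps j} \<subseteq> U}"
    let ?V = "\<Union>(ps, j) \<in> ?S. tube ps j"
    have "?V \<in> sets borel"
      by (rule sets.countable_UN'[of ?S]) (auto intro: tube_measurable)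
    moreover have "U = {w \<in> paths. coords w \<in> ?V}"
    proof (intro set_eqI iffI)
      fix w assume w: "w \<in> U"
      then have wp: "w \<in> paths" using openin_subset[OF U] by auto
      then have wc: "continuous_on T w" by (simp add: paths_iff)
      obtain e where e: "0 < e" "\<And>v. v \<in> paths \<Longrightarrow> (\<And>t. t \<in> T \<Longrightarrow> \<bar>v t - w t\<bar> \<le> e) \<Longrightarrow> v \<in> U"
        using openin_path_spaceD[OF U w] by metis
      obtain j where j: "2 / (real j + 1) \<le> e"
      proof -
        obtain j :: nat where "2 / e < real j" using reals_Archimedean2 by blast
        then have "2 / (real j + 1) \<le> e" using e(1) by (simp add: field_simps)
        then show ?thesis by (rule that)
      qed
      obtain ps where ps: "coords w \<in> tube ps j" "\<And>t. t \<in> T \<Longrightarrow> \<exists>(p, q, v) \<in> set ps. of_rat p < t \<and> t < of_rat q"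
        using tube_exists[OF wc] by metis
      have "{w \<in> paths. coords w \<in> tube ps j} \<subseteq> U"
      proof clarify
        fix v assume v: "v \<in> paths" "coords v \<in> tube ps j"
        show "v \<in> U"
        proof (rule e(2)[OF v(1)])
          fix t assume t: "t \<in> T"
          have "\<bar>v t - w t\<bar> \<le> 2 / (real j + 1)"
            by (rule tube_diameter[OF ps(2) _ v(2) wc ps(1) t]) (use v(1) in \<open>auto simp: paths_iff\<close>)
          then show "\<bar>v t - w t\<bar> \<le> e" using j by simp
        qed
      qed
      then show "w \<in> {w \<in> paths. coords w \<in> ?V}" using ps(1) wp by blast
    qed auto
    ultimately show ?case by blast
  next
    case Empty
    show ?case by (intro bexI[of _ "{}"]) auto
  next
    case (Compl A)
    then obtain A' where "A' \<in> sets borel" "A = {w \<in> paths. coords w \<in> A'}" by blast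
    then show ?case by (intro bexI[of _ "- A'"]) auto
  next
    case (Union A)
    then obtain A' where "\<And>i. A' i \<in> sets borel" "\<And>i. A i = {w \<in> paths. coords w \<in> A' i}" by metis
    then show ?case by (intro bexI[of _ "\<Union>i. A' i"]) auto
  qed
  moreover have "A \<in> sigma_sets paths {U. openin (mtopology_of (path_space T)) U}"
    using assms unfolding path_borel_def
    by (subst (asm) sets_measure_of) (use openin_subset in fastforce)+
  ultimately show ?thesis using that by blast
qed

lemma coords_measurable: "(\<lambda>w. coords w) \<in> borel_measurable (path_filtration T 1)"
  unfolding coords_def by (intro measurable_coordinatewise_then_product measurable_eval dense_seq T_bounds)

text \<open>Allows measurability into the path space to be checked one coordinate at a time.\<close>

lemma sets_path_borel: "sets (path_borel T) = sets (path_filtration T 1)"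
proof (intro equalityI subsetI)
  fix A assume "A \<in> sets (path_borel T)"
  then obtain A' where A': "A' \<in> sets borel" "A = {w \<in> paths. coords w \<in> A'}" by (rule path_borel_coords)
  then have "A = coords -` A' \<inter> space (path_filtration T 1)" by auto
  then show "A \<in> sets (path_filtration T 1)" using measurable_sets[OF coords_measurable A'(1)] by simp
next
  fix A assume "A \<in> sets (path_filtration T 1)"
  moreover have "(\<lambda>w. w) \<in> path_borel T \<rightarrow>\<^sub>M path_filtration T 1"
    by (rule measurable_path_filtration) (auto intro: eval_path_borel)
  ultimately have "(\<lambda>w. w) -` A \<inter> space (path_borel T) \<in> sets (path_borel T)"
    by (intro measurable_sets)
  moreover have "(\<lambda>w. w) -` A \<inter> space (path_borel T) = A"
    using sets.sets_into_space[OF \<open>A \<in> sets (path_filtration T 1)\<close>] by auto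
  ultimately show "A \<in> sets (path_borel T)" by simp
qed

lemma measurable_path_borel:
  assumes "\<And>\<omega>. \<omega> \<in> space M \<Longrightarrow> F \<omega> \<in> paths"
    and "\<And>s. s \<in> T \<Longrightarrow> (\<lambda>\<omega>. F \<omega> s) \<in> borel_measurable M"
  shows "F \<in> M \<rightarrow>\<^sub>M path_borel T"
  using measurable_path_filtration[OF assms, of 1] measurable_cong_sets[OF refl sets_path_borel] by blast

end

section \<open>Measurability and adaptedness of the solution map\<close>

context sine_drift
begin

lemma gap_drift_measurable:
  assumes "finite K" "K \<subseteq> left_scattered" "t \<in> T" "\<And>s. s \<in> T \<Longrightarrow> s \<le> t \<Longrightarrow> (\<lambda>\<omega>. x \<omega> s) \<in> borel_measurable M"
  shows "(\<lambda>\<omega>. gap_drift K (x \<omega>) t) \<in> borel_measurable M"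
proof -
  have [measurable]: "(\<lambda>\<omega>. x \<omega> (rho r)) \<in> borel_measurable M" "(\<lambda>\<omega>. x \<omega> (rho (rho r))) \<in> borel_measurable M"
    if "r \<in> {r \<in> K. r \<le> t}" for r
  proof -
    have r: "r \<in> left_scattered" "r \<le> t" using that assms(2) by auto
    note rs = left_scatteredD[OF r(1)]
    show "(\<lambda>\<omega>. x \<omega> (rho r)) \<in> borel_measurable M" using r rs by (intro assms(4)) auto
    show "(\<lambda>\<omega>. x \<omega> (rho (rho r))) \<in> borel_measurable M"
      using r rs rho_mem[OF rs(4)] rho_le[OF rs(4)] by (intro assms(4)) auto
  qed
  show ?thesis
    unfolding gap_drift_def jump_def by measurable
qed

text \<open>As a limit of finite sums the integral needs no joint measurability in time and path.
  With \<open>M\<close> arbitrary and only times up to \<open>t\<close> in the hypothesis, the lemma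
  yields Borel measurability and adaptedness alike.\<close>

lemma drift_measurable:
  assumes "t \<in> T" "\<And>s. s \<in> T \<Longrightarrow> s \<le> t \<Longrightarrow> (\<lambda>\<omega>. x \<omega> s) \<in> borel_measurable M"
  shows "(\<lambda>\<omega>. drift (x \<omega>) t) \<in> borel_measurable M"
proof -
  obtain K :: "nat \<Rightarrow> real set" where K: "\<And>n. finite (K n)" "\<And>n. K n \<subseteq> left_scattered"
    "\<And>r. r \<in> left_scattered \<Longrightarrow> \<forall>\<^sub>F n in sequentially. r \<in> K n"
    using left_scattered_exhaustion by metis
  show ?thesis
    by (rule borel_measurable_LIMSEQ_real[OF gap_drift_tendsto[OF K assms(1)]])
      (auto intro!: gap_drift_measurable assms(2) intro: K(3) subsetD[OF K(2)] simp: K(1) assms(1))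
qed

lemma solution_measurable:
  assumes t: "t \<in> T" and x: "\<And>s. s \<in> T \<Longrightarrow> s \<le> t \<Longrightarrow> (\<lambda>\<omega>. x \<omega> s) \<in> borel_measurable M"
  shows "(\<lambda>\<omega>. solution (x \<omega>) t) \<in> borel_measurable M"
proof -
  have "(\<lambda>\<omega>. picard (x \<omega>) n s) \<in> borel_measurable M" if "s \<in> T" "s \<le> t" for n s
    using that
  proof (induction n arbitrary: s)
    case (Suc n)
    then show ?case using x by (auto intro!: borel_measurable_add drift_measurable)
  qed (simp add: x)
  then show ?thesis
    by (intro borel_measurable_LIMSEQ_real[OF picard_tendsto]) (use t in auto)
qed

lemma continuous_on_drift: "continuous_on T (drift x)"
proof (rule continuous_onI)
  fix s and e :: real assume s: "s \<in> T" and e: "0 < e"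
  have "dist (drift x t) (drift x s) \<le> dist t s" if t: "t \<in> T" for t
  proof -
    have *: "\<bar>drift x v - drift x u\<bar> \<le> v - u" if "u \<in> T" "u \<le> v" for u v
    proof -
      have "\<bar>a\<bar> * (v - u) \<le> 1 * (v - u)" using a_less that by (intro mult_right_mono) auto
      then show ?thesis using drift_Lipschitz[of u v x] T_bounds that by fastforce
    qed
    show ?thesis using *[of s t] *[of t s] s t by (cases "s \<le> t") (auto simp: dist_real_def)
  qed
  then show "\<exists>d>0. \<forall>x'\<in>T. dist x' s < d \<longrightarrow> dist (drift x x') (drift x s) \<le> e"
    using e by (intro exI[of _ e]) force
qed

lemma unshift_in_paths: "w \<in> paths \<Longrightarrow> unshift w \<in> paths"
  using zero_mem continuous_on_drift[of w]
  by (auto simp: paths_iff unshift_def drift_0 intro!: continuous_intros cong: continuous_on_cong)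

lemma solution_in_paths:
  assumes "w \<in> paths" shows "solution w \<in> paths"
proof -
  have "continuous_on T (\<lambda>t. w t + drift (solution w) t)"
    using assms by (intro continuous_intros continuous_on_drift) (simp add: paths_iff)
  then have "continuous_on T (solution w)" using solution_eq[of _ w] by (simp cong: continuous_on_cong)
  moreover have "solution w 0 = 0" using solution_eq[OF zero_mem, of w] assms by (simp add: paths_iff drift_0)
  ultimately show ?thesis by (simp add: paths_iff) (simp add: solution_def)
qed

lemma solution_unshift_path: "w \<in> paths \<Longrightarrow> solution (unshift w) = w"
  using solution_unshift[of _ w] by (intro extensionalityI[of _ T]) (auto simp: paths_iff solution_def)

lemma solution_path_borel: "solution \<in> path_borel T \<rightarrow>\<^sub>M path_borel T"
  by (rule measurable_path_borel) (auto intro: solution_in_paths solution_measurable eval_path_borel)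

lemma unshift_path_borel: "unshift \<in> path_borel T \<rightarrow>\<^sub>M path_borel T"
proof (rule measurable_path_borel)
  show "(\<lambda>w. unshift w s) \<in> borel_measurable (path_borel T)" if "s \<in> T" for s
    using that by (auto simp: unshift_def intro!: borel_measurable_diff drift_measurable eval_path_borel)
qed (simp add: unshift_in_paths)

text \<open>The iteration works path by path, so the map respects the raw filtration, which lies
  inside the augmented one.\<close>

lemma solution_adapted: "solution \<in> path_filtration T t \<rightarrow>\<^sub>M path_filtration T t"
  by (rule measurable_path_filtration)
    (auto intro: solution_in_paths intro!: solution_measurable measurable_eval)

end

subsection \<open>Gaussian increments\<close>

abbreviation gauss :: "real \<Rightarrow> real measure" where
  "gauss h \<equiv> density lborel (normal_density 0 (sqrt h))"

lemma prob_space_gauss: "0 < h \<Longrightarrow> prob_space (gauss h)"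
  by (rule prob_space_normal_density) simp

lemma char_gauss:
  assumes "0 < h"
  shows "char (gauss h) \<theta> = complex_of_real (exp (- h * \<theta>\<^sup>2 / 2))"
proof -
  have "distributed std_normal_distribution lborel (\<lambda>x. x) std_normal_density"
    by (auto simp: distributed_def distr_id2)
  then interpret std: prob_space std_normal_distribution
    by (intro prob_space_normal_density) simp
  have "distributed std_normal_distribution lborel (\<lambda>x. 0 + sqrt h * x) (normal_density (0 + sqrt h * 0) (\<bar>sqrt h\<bar> * 1))"
    by (rule std.normal_density_affine) (use assms in \<open>auto simp: distributed_def distr_id2\<close>)
  then have "gauss h = distr std_normal_distribution lborel (\<lambda>x. sqrt h * x)"
    using assms by (simp add: distributed_distr_eq_density)
  then have "char (gauss h) \<theta> = char std_normal_distribution (sqrt h * \<theta>)"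
    unfolding char_def by (simp add: integral_distr mult_ac)
  then show ?thesis using assms by (simp add: char_std_normal_distribution power_mult_distrib)
qed

text \<open>The Cameron-Martin formula in dimension one, by completing the square: the exponential
  turns the centred Gaussian into one with mean \<open>c * h\<close>, which the argument of
  \<open>\<phi>\<close> removes again.\<close>

lemma nn_integral_gauss_shift:
  fixes \<phi> :: "real \<Rightarrow> ennreal"
  assumes [measurable]: "\<phi> \<in> borel_measurable borel" and h: "0 < h"
  shows "(\<integral>\<^sup>+x. ennreal (exp (c * x - c\<^sup>2 * h / 2)) * \<phi> (x - c * h) \<partial>gauss h) = (\<integral>\<^sup>+x. \<phi> x \<partial>gauss h)"
proof -
  \<comment> \<open>The factor \<open>1 *\<close> matches the shape that the affine substitution
    with slope 1 produces.\<close>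
  have dens: "normal_density 0 (sqrt h) (c * h + 1 * x) * exp (c * (c * h + 1 * x) - c\<^sup>2 * h / 2) = normal_density 0 (sqrt h) x" for x
  proof -
    have "- (c * h + x)\<^sup>2 / (2 * h) + (c * (c * h + x) - c\<^sup>2 * h / 2) = - x\<^sup>2 / (2 * h)"
      using h by (simp add: field_simps power2_eq_square)
    then show ?thesis using h
      by (simp add: normal_density_def exp_add[symmetric])
  qed
  have "(\<integral>\<^sup>+x. ennreal (exp (c * x - c\<^sup>2 * h / 2)) * \<phi> (x - c * h) \<partial>gauss h)
     = (\<integral>\<^sup>+x. ennreal (normal_density 0 (sqrt h) x * exp (c * x - c\<^sup>2 * h / 2)) * \<phi> (x - c * h) \<partial>lborel)"
    by (simp add: nn_integral_density ennreal_mult mult_ac)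
  also have "\<dots> = (\<integral>\<^sup>+x. ennreal (normal_density 0 (sqrt h) (c * h + 1 * x) * exp (c * (c * h + 1 * x) - c\<^sup>2 * h / 2))
        * \<phi> (c * h + 1 * x - c * h) \<partial>lborel)"
    by (subst nn_integral_real_affine[where c = 1 and t = "c * h"]) auto
  also have "\<dots> = (\<integral>\<^sup>+x. \<phi> x \<partial>gauss h)"
    unfolding dens by (simp add: nn_integral_density)
  finally show ?thesis .
qed

text \<open>Condition on \<open>A\<close>: under the normalised measure \<open>N\<close>, the
  variable \<open>D\<close> has the characteristic function of \<open>gauss h\<close>, so Levy's
  uniqueness theorem gives its law. Multiplying by the probability of \<open>A\<close> gives the
  claim.\<close>

lemma (in prob_space) iexp_moment_imp_indep_gauss:
  assumes D [measurable]: "D \<in> borel_measurable M" and A [measurable]: "A \<in> sets M" and U: "U \<in> sets borel" and h: "0 < h"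
    and char: "\<And>\<theta>. (CLINT x|M. indicator A x *\<^sub>R iexp (\<theta> * D x)) = complex_of_real (exp (- h * \<theta>\<^sup>2 / 2) * prob A)"
  shows "emeasure M (A \<inter> (D -` U \<inter> space M)) = emeasure M A * emeasure (gauss h) U"
proof (cases "prob A = 0")
  case True
  then have "emeasure M A = 0" by (simp add: emeasure_eq_measure)
  moreover have "emeasure M (A \<inter> (D -` U \<inter> space M)) \<le> emeasure M A" by (rule emeasure_mono) auto
  ultimately show ?thesis by simp
next
  case False
  then have pos: "0 < prob A" by (simp add: zero_less_measure_iff)
  define N where "N = density M (\<lambda>x. ennreal (indicator A x / prob A))"
  have em: "emeasure N X = emeasure M (A \<inter> X) / ennreal (prob A)" if "X \<in> sets M" for X
  proof -
    have "emeasure N X = (\<integral>\<^sup>+x. indicator (A \<inter> X) x / ennreal (prob A) \<partial>M)"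
      unfolding N_def using that pos
      by (subst emeasure_density) (auto intro!: nn_integral_cong simp: indicator_def divide_ennreal[symmetric])
    also have "\<dots> = emeasure M (A \<inter> X) / ennreal (prob A)"
      using that by (simp add: nn_integral_divide)
    finally show ?thesis .
  qed
  have "prob_space N"
  proof
    have "A \<inter> space M = A" using sets.sets_into_space[OF A] by blast
    then show "emeasure N (space N) = 1"
      using em[of "space M"] pos by (simp add: N_def emeasure_eq_measure ennreal_divide_self)
  qed
  then interpret N: prob_space N .
  have DN [measurable]: "D \<in> borel_measurable N" by (simp add: N_def)
  have "distr N borel D = gauss h"
  proof (rule Levy_uniqueness)
    show "real_distribution (distr N borel D)" by (rule N.real_distribution_distr) simp
    show "real_distribution (gauss h)"
      using prob_space_gauss[OF h] by (simp add: real_distribution_def real_distribution_axioms_def)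
    show "char (distr N borel D) = char (gauss h)"
    proof
      fix \<theta>
      have "char (distr N borel D) \<theta> = (CLINT x|N. iexp (\<theta> * D x))"
        unfolding char_def by (subst integral_distr) auto
      also have "\<dots> = (CLINT x|M. (indicator A x / prob A) *\<^sub>R iexp (\<theta> * D x))"
        unfolding N_def by (subst integral_density) auto
      also have "\<dots> = (1 / prob A) *\<^sub>R (CLINT x|M. indicator A x *\<^sub>R iexp (\<theta> * D x))"
        by (subst integral_scaleR_right[symmetric]) simp
      also have "\<dots> = char (gauss h) \<theta>"
        unfolding char char_gauss[OF h] using pos by (simp add: scaleR_conv_of_real)
      finally show "char (distr N borel D) \<theta> = char (gauss h) \<theta>" .
    qed
  qed
  then have "emeasure (gauss h) U = emeasure (distr N borel D) U" by simp
  also have "\<dots> = emeasure M (A \<inter> (D -` U \<inter> space M)) / ennreal (prob A)"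
    using U measurable_sets[OF D U] em[of "D -` U \<inter> space M"]
    by (subst emeasure_distr) (auto simp: N_def)
  finally show ?thesis using pos
    by (simp add: emeasure_eq_measure divide_ennreal ennreal_mult[symmetric])
qed

text \<open>\<open>indep_gauss\<close> states the law of an increment and its independence of the
  past at once, as the value of a product measure on rectangles.\<close>

locale gaussian_increments = prob_space M for M :: "'w measure" +
  fixes T :: "real set" and \<A> :: "real \<Rightarrow> 'w measure" and B :: "real \<Rightarrow> 'w \<Rightarrow> real"
  assumes subalg: "t \<in> T \<Longrightarrow> subalgebra M (\<A> t)"
    and filtration_mono: "s \<in> T \<Longrightarrow> t \<in> T \<Longrightarrow> s \<le> t \<Longrightarrow> sets (\<A> s) \<subseteq> sets (\<A> t)"
    and adapted: "t \<in> T \<Longrightarrow> B t \<in> borel_measurable (\<A> t)"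
    and start: "0 \<in> T" "\<omega> \<in> space M \<Longrightarrow> B 0 \<omega> = 0"
    and indep_gauss: "s \<in> T \<Longrightarrow> t \<in> T \<Longrightarrow> s < t \<Longrightarrow> A \<in> sets (\<A> s) \<Longrightarrow> U \<in> sets borel \<Longrightarrow>
      emeasure M (A \<inter> ((\<lambda>\<omega>. B t \<omega> - B s \<omega>) -` U \<inter> space M)) = emeasure M A * emeasure (gauss (t - s)) U"
begin

section \<open>Girsanov's theorem in discrete time\<close>

lemma space_filtration: "t \<in> T \<Longrightarrow> space (\<A> t) = space M"
  using subalg by (simp add: subalgebra_def)

lemma measurable_later:
  assumes "s \<in> T" "t \<in> T" "s \<le> t" "f \<in> measurable (\<A> s) N" shows "f \<in> measurable (\<A> t) N"
  using assms filtration_mono[OF assms(1-3)] space_filtration unfolding measurable_def by auto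

lemma measurable_whole: "t \<in> T \<Longrightarrow> f \<in> measurable (\<A> t) N \<Longrightarrow> f \<in> measurable M N"
  using measurable_from_subalg[OF subalg] .

lemma B_measurable: "t \<in> T \<Longrightarrow> B t \<in> borel_measurable M"
  by (rule measurable_whole[OF _ adapted])

text \<open>Freezing the past: the joint law of the sample point, seen through
  \<open>\<A> s\<close>, and the increment is a product measure, so Tonelli's theorem
  applies.\<close>

lemma nn_integral_increment:
  fixes \<phi> :: "'w \<times> real \<Rightarrow> ennreal"
  assumes st: "s \<in> T" "t \<in> T" "s < t" and \<phi>: "\<phi> \<in> borel_measurable (\<A> s \<Otimes>\<^sub>M borel)"
  shows "(\<integral>\<^sup>+\<omega>. \<phi> (\<omega>, B t \<omega> - B s \<omega>) \<partial>M) = (\<integral>\<^sup>+\<omega>. (\<integral>\<^sup>+x. \<phi> (\<omega>, x) \<partial>gauss (t - s)) \<partial>M)"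
proof -
  let ?R = "restr_to_subalg M (\<A> s)" and ?G = "gauss (t - s)"
  let ?D = "\<lambda>\<omega>. B t \<omega> - B s \<omega>"
  note sub = subalg[OF st(1)]
  have D: "?D \<in> borel_measurable M" using B_measurable[OF st(1)] B_measurable[OF st(2)] by simp
  have setsR: "sets ?R = sets (\<A> s)" by (rule sets_restr_to_subalg[OF sub])
  have pair: "(\<lambda>\<omega>. (\<omega>, ?D \<omega>)) \<in> M \<rightarrow>\<^sub>M \<A> s \<Otimes>\<^sub>M borel"
    by (intro measurable_Pair measurable_from_subalg[OF sub measurable_ident_sets] D) simp
  have sG: "prob_space ?G" using st prob_space_gauss by simp
  have eq: "?R \<Otimes>\<^sub>M ?G = distr M (\<A> s \<Otimes>\<^sub>M borel) (\<lambda>\<omega>. (\<omega>, ?D \<omega>))"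
  proof (rule pair_measure_eqI)
    show "sigma_finite_measure ?R"
      using prob_space_restr_to_subalg[OF sub] prob_space_axioms prob_space_imp_sigma_finite by blast
    show "sigma_finite_measure ?G" using sG by (rule prob_space_imp_sigma_finite)
    show "sets (?R \<Otimes>\<^sub>M ?G) = sets (distr M (\<A> s \<Otimes>\<^sub>M borel) (\<lambda>\<omega>. (\<omega>, ?D \<omega>)))"
      using setsR by (simp cong: sets_pair_measure_cong)
  next
    fix A U assume "A \<in> sets ?R" "U \<in> sets ?G"
    then have A: "A \<in> sets (\<A> s)" and U: "U \<in> sets borel" using setsR by auto
    have "emeasure (distr M (\<A> s \<Otimes>\<^sub>M borel) (\<lambda>\<omega>. (\<omega>, ?D \<omega>))) (A \<times> U)
        = emeasure M ((\<lambda>\<omega>. (\<omega>, ?D \<omega>)) -` (A \<times> U) \<inter> space M)"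
      using A U by (intro emeasure_distr[OF pair]) auto
    also have "(\<lambda>\<omega>. (\<omega>, ?D \<omega>)) -` (A \<times> U) \<inter> space M = A \<inter> (?D -` U \<inter> space M)" by auto
    also have "emeasure M \<dots> = emeasure ?R A * emeasure ?G U"
      using indep_gauss[OF st A U] emeasure_restr_to_subalg[OF sub A] by simp
    finally show "emeasure ?R A * emeasure ?G U = emeasure (distr M (\<A> s \<Otimes>\<^sub>M borel) (\<lambda>\<omega>. (\<omega>, ?D \<omega>))) (A \<times> U)"
      by simp
  qed
  interpret G: sigma_finite_measure ?G using sG by (rule prob_space_imp_sigma_finite)
  have \<phi>': "\<phi> \<in> borel_measurable (?R \<Otimes>\<^sub>M ?G)"
    using \<phi> setsR by (simp cong: measurable_cong_sets sets_pair_measure_cong)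
  have "(\<integral>\<^sup>+\<omega>. \<phi> (\<omega>, ?D \<omega>) \<partial>M) = (\<integral>\<^sup>+p. \<phi> p \<partial>(?R \<Otimes>\<^sub>M ?G))"
    unfolding eq using \<phi> by (subst nn_integral_distr[OF pair]) auto
  also have "\<dots> = (\<integral>\<^sup>+\<omega>. (\<integral>\<^sup>+x. \<phi> (\<omega>, x) \<partial>?G) \<partial>?R)"
    by (rule G.nn_integral_fst[symmetric, OF \<phi>'])
  also have "\<dots> = (\<integral>\<^sup>+\<omega>. (\<integral>\<^sup>+x. \<phi> (\<omega>, x) \<partial>?G) \<partial>M)"
    by (rule nn_integral_subalgebra2[OF sub])
      (use G.borel_measurable_nn_integral_fst[OF \<phi>'] setsR in \<open>simp cong: measurable_cong_sets\<close>)
  finally show ?thesis .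
qed

text \<open>With the past frozen, \<open>Z\<close>, \<open>c\<close> and \<open>Y\<close> are
  constants and the Gaussian shift applies for each sample point. The free weight \<open>Z\<close>
  carries the earlier factors in the induction below.\<close>

lemma girsanov_step:
  fixes Z :: "'w \<Rightarrow> ennreal" and g :: "real \<Rightarrow> ennreal"
  assumes st: "s \<in> T" "t \<in> T" "s < t" 
    and Z [measurable]: "Z \<in> borel_measurable (\<A> s)" and c [measurable]: "c \<in> borel_measurable (\<A> s)"
    and Y [measurable]: "Y \<in> borel_measurable (\<A> s)" and g [measurable]: "g \<in> borel_measurable borel"
  shows "(\<integral>\<^sup>+\<omega>. Z \<omega> * ennreal (exp (c \<omega> * (B t \<omega> - B s \<omega>) - (c \<omega>)\<^sup>2 * (t - s) / 2))
            * g (Y \<omega> + (B t \<omega> - B s \<omega>) - c \<omega> * (t - s)) \<partial>M)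
       = (\<integral>\<^sup>+\<omega>. Z \<omega> * (\<integral>\<^sup>+x. g (Y \<omega> + x) \<partial>gauss (t - s)) \<partial>M)"
proof -
  let ?\<phi> = "\<lambda>(\<omega>, x). Z \<omega> * ennreal (exp (c \<omega> * x - (c \<omega>)\<^sup>2 * (t - s) / 2)) * g (Y \<omega> + x - c \<omega> * (t - s))"
  have "?\<phi> \<in> borel_measurable (\<A> s \<Otimes>\<^sub>M borel)" by measurable
  from nn_integral_increment[OF st this]
  have "(\<integral>\<^sup>+\<omega>. Z \<omega> * ennreal (exp (c \<omega> * (B t \<omega> - B s \<omega>) - (c \<omega>)\<^sup>2 * (t - s) / 2))
            * g (Y \<omega> + (B t \<omega> - B s \<omega>) - c \<omega> * (t - s)) \<partial>M)
      = (\<integral>\<^sup>+\<omega>. (\<integral>\<^sup>+x. Z \<omega> * (ennreal (exp (c \<omega> * x - (c \<omega>)\<^sup>2 * (t - s) / 2)) * g (Y \<omega> + (x - c \<omega> * (t - s)))) \<partial>gauss (t - s)) \<partial>M)"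
    by (simp add: add_diff_eq mult.assoc)
  also have "\<dots> = (\<integral>\<^sup>+\<omega>. Z \<omega> * (\<integral>\<^sup>+x. g (Y \<omega> + x) \<partial>gauss (t - s)) \<partial>M)"
    using st by (intro nn_integral_cong) (simp add: nn_integral_cmult nn_integral_gauss_shift[of "\<lambda>x. g (Y _ + x)"])
  finally show ?thesis .
qed

text \<open>Induction that removes the last increment on both sides. Products of functions of single
  positions suffice because they include the indicators of cylinder sets.\<close>

lemma girsanov_grid:
  fixes c :: "nat \<Rightarrow> 'w \<Rightarrow> real" and g :: "nat \<Rightarrow> real \<Rightarrow> ennreal"
  assumes "u 0 = 0" "\<And>i. i \<le> n \<Longrightarrow> u i \<in> T" "\<And>i. i < n \<Longrightarrow> u i < u (Suc i)"
    and "\<And>i. i < n \<Longrightarrow> c i \<in> borel_measurable (\<A> (u i))" and "\<And>i. g i \<in> borel_measurable borel"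
  shows "(\<integral>\<^sup>+\<omega>. (\<Prod>i<n. ennreal (exp (c i \<omega> * (B (u (Suc i)) \<omega> - B (u i) \<omega>) - (c i \<omega>)\<^sup>2 * (u (Suc i) - u i) / 2)))
            * (\<Prod>i\<le>n. g i (B (u i) \<omega> - (\<Sum>j<i. c j \<omega> * (u (Suc j) - u j)))) \<partial>M)
       = (\<integral>\<^sup>+\<omega>. (\<Prod>i\<le>n. g i (B (u i) \<omega>)) \<partial>M)"
  using assms
proof (induction n arbitrary: g)
  case 0
  then show ?case by simp
next
  case (Suc n)
  let ?s = "u n" and ?t = "u (Suc n)"
  have st: "?s \<in> T" "?t \<in> T" "?s < ?t" using Suc.prems by auto
  define K where "K y = (\<integral>\<^sup>+x. g (Suc n) (y + x) \<partial>gauss (?t - ?s))" for y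
  have gm [measurable]: "g i \<in> borel_measurable borel" for i using Suc.prems(5) .
  interpret G: sigma_finite_measure "gauss (?t - ?s)"
    using st by (intro prob_space_imp_sigma_finite prob_space_gauss) simp
  have K [measurable]: "K \<in> borel_measurable borel"
    unfolding K_def by measurable
  \<comment> \<open>Integrating out the last increment leaves a function \<open>K\<close> of the
    position at \<open>u n\<close>; it is absorbed into factor \<open>n\<close>, so that the
    induction hypothesis applies.\<close>
  define g' where "g' i = (if i = n then (\<lambda>y. g n y * K y) else g i)" for i
  have g': "g' i \<in> borel_measurable borel" for i unfolding g'_def by auto
  have le: "?s \<in> T \<and> u i \<in> T \<and> u i \<le> ?s" if "i \<le> n" for i
  proof -
    have "u i \<le> u m" if "i \<le> m" "m \<le> n" for m
      using that
    proof (induction m rule: dec_induct)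
      case (step m)
      then show ?case using Suc.prems(3)[of m] by simp
    qed simp
    then show ?thesis using that Suc.prems(2) by auto
  qed
  have Bm [measurable]: "B (u i) \<in> borel_measurable (\<A> ?s)" if "i \<le> n" for i
    using le[OF that] by (auto intro: measurable_later adapted)
  have cm [measurable]: "c i \<in> borel_measurable (\<A> ?s)" if "i \<le> n" for i
    using le[OF that] Suc.prems(4)[of i] that by (auto intro: measurable_later)
  have step: "(\<integral>\<^sup>+\<omega>. Z \<omega> * ennreal (exp (c \<omega> * (B ?t \<omega> - B ?s \<omega>) - (c \<omega>)\<^sup>2 * (?t - ?s) / 2))
            * g (Suc n) (Y \<omega> + (B ?t \<omega> - B ?s \<omega>) - c \<omega> * (?t - ?s)) \<partial>M)
       = (\<integral>\<^sup>+\<omega>. Z \<omega> * K (Y \<omega>) \<partial>M)"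
    if "Z \<in> borel_measurable (\<A> ?s)" "c \<in> borel_measurable (\<A> ?s)" "Y \<in> borel_measurable (\<A> ?s)" for Z c Y
    unfolding K_def by (rule girsanov_step[OF st that gm])
  have prod_g': "(\<Prod>i\<le>n. g i (y i)) * K (y n) = (\<Prod>i\<le>n. g' i (y i))" for y
    by (cases n) (auto simp: g'_def mult_ac intro!: prod.cong)
  let ?E = "\<lambda>i \<omega>. ennreal (exp (c i \<omega> * (B (u (Suc i)) \<omega> - B (u i) \<omega>) - (c i \<omega>)\<^sup>2 * (u (Suc i) - u i) / 2))"
  let ?Y = "\<lambda>i \<omega>. B (u i) \<omega> - (\<Sum>j<i. c j \<omega> * (u (Suc j) - u j))"
  let ?Z = "\<lambda>\<omega>. (\<Prod>i<n. ?E i \<omega>) * (\<Prod>i\<le>n. g i (?Y i \<omega>))"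
  have Ym: "?Y i \<in> borel_measurable (\<A> ?s)" if "i \<le> n" for i
    using that by (intro borel_measurable_diff borel_measurable_sum borel_measurable_times Bm cm) auto
  have Zm: "?Z \<in> borel_measurable (\<A> ?s)"
  proof (intro borel_measurable_times_ennreal borel_measurable_prod_ennreal)
    show "?E i \<in> borel_measurable (\<A> ?s)" if "i \<in> {..<n}" for i
      using that cm[of i] Bm[of i] Bm[of "Suc i"] by auto
    show "(\<lambda>\<omega>. g i (?Y i \<omega>)) \<in> borel_measurable (\<A> ?s)" if "i \<in> {..n}" for i
      by (rule measurable_compose[OF Ym gm]) (use that in auto)
  qed
  have "(\<integral>\<^sup>+\<omega>. (\<Prod>i<Suc n. ?E i \<omega>) * (\<Prod>i\<le>Suc n. g i (?Y i \<omega>)) \<partial>M)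
      = (\<integral>\<^sup>+\<omega>. ?Z \<omega> * ?E n \<omega> * g (Suc n) (?Y n \<omega> + (B ?t \<omega> - B ?s \<omega>) - c n \<omega> * (?t - ?s)) \<partial>M)"
    by (intro nn_integral_cong) (simp add: mult_ac algebra_simps)
  also have "\<dots> = (\<integral>\<^sup>+\<omega>. ?Z \<omega> * K (?Y n \<omega>) \<partial>M)"
    by (rule step[OF Zm cm Ym]) auto
  also have "\<dots> = (\<integral>\<^sup>+\<omega>. (\<Prod>i<n. ?E i \<omega>) * (\<Prod>i\<le>n. g' i (?Y i \<omega>)) \<partial>M)"
    by (simp add: prod_g'[of "\<lambda>i. ?Y i _", symmetric] mult.assoc)
  also have "\<dots> = (\<integral>\<^sup>+\<omega>. (\<Prod>i\<le>n. g' i (B (u i) \<omega>)) \<partial>M)"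
    by (rule Suc.IH) (use Suc.prems g' in auto)
  also have "\<dots> = (\<integral>\<^sup>+\<omega>. (\<Prod>i\<le>n. g i (B (u i) \<omega>)) * K (B ?s \<omega>) \<partial>M)"
    by (simp add: prod_g'[of "\<lambda>i. B (u i) _", symmetric])
  \<comment> \<open>The same step with coefficient 0, read backwards, restores the last factor for
    the undrifted path.\<close>
  also have "\<dots> = (\<integral>\<^sup>+\<omega>. (\<Prod>i\<le>n. g i (B (u i) \<omega>)) * ennreal (exp (0 * (B ?t \<omega> - B ?s \<omega>) - 0\<^sup>2 * (?t - ?s) / 2))
            * g (Suc n) (B ?s \<omega> + (B ?t \<omega> - B ?s \<omega>) - 0 * (?t - ?s)) \<partial>M)"
    by (rule step[symmetric]) (auto intro!: borel_measurable_prod_ennreal measurable_compose[OF Bm gm] Bm)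
  also have "\<dots> = (\<integral>\<^sup>+\<omega>. (\<Prod>i\<le>Suc n. g i (B (u i) \<omega>)) \<partial>M)"
    by simp
  finally show ?case .
qed

end

subsection \<open>Null sets of limit laws\<close>

text \<open>Serves to bound an unbounded density by a constant \<open>N\<close> plus its square over
  \<open>N\<close>, with \<open>N\<close> free.\<close>

lemma two_mult_le_add_square_div: "2 * x \<le> N + x\<^sup>2 / N" if "0 < N" for x N :: real
proof -
  have "0 \<le> (x - N)\<^sup>2 / N" using that by simp
  also have "\<dots> = N + x\<^sup>2 / N - 2 * x" using that by (simp add: field_simps power2_eq_square)
  finally show ?thesis by simp
qed

lemma tendsto_funI:
  fixes f :: "'a \<Rightarrow> 'i \<Rightarrow> 'b::topological_space"
  assumes "\<And>i. ((\<lambda>x. f x i) \<longlongrightarrow> l i) F"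
  shows "(f \<longlongrightarrow> l) F"
proof -
  have "limitin (product_topology (\<lambda>_. euclidean) UNIV) f l F"
    using assms by (simp add: limitin_componentwise)
  then show ?thesis by (simp add: euclidean_product_topology)
qed

text \<open>A limit inside an open set forces the sequence to enter it for good, so the increasing
  events \<open>V m\<close> exhaust the limit event, and each has probability at most
  \<open>c\<close>.\<close>

lemma (in prob_space) prob_open_limit_le:
  fixes \<gamma> :: "'a \<Rightarrow> 'b::topological_space"
  assumes [measurable]: "\<gamma> \<in> borel_measurable M" "\<And>n. \<gamma>n n \<in> borel_measurable M"
    and lim: "\<And>\<omega>. \<omega> \<in> space M \<Longrightarrow> (\<lambda>n. \<gamma>n n \<omega>) \<longlonglongrightarrow> \<gamma> \<omega>"
    and U: "open U" and le: "\<And>n. prob {\<omega> \<in> space M. \<gamma>n n \<omega> \<in> U} \<le> c"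
  shows "prob {\<omega> \<in> space M. \<gamma> \<omega> \<in> U} \<le> c"
proof -
  have [measurable]: "U \<in> sets borel" using U by simp
  define V where "V m = {\<omega> \<in> space M. \<forall>n\<ge>m. \<gamma>n n \<omega> \<in> U}" for m
  have [measurable]: "V m \<in> sets M" for m unfolding V_def by measurable
  have "incseq V" unfolding V_def by (auto simp: incseq_def)
  then have "(\<lambda>m. prob (V m)) \<longlonglongrightarrow> prob (\<Union>m. V m)"
    by (intro finite_Lim_measure_incseq) auto
  moreover have "prob (V m) \<le> c" for m
  proof -
    have "prob (V m) \<le> prob {\<omega> \<in> space M. \<gamma>n m \<omega> \<in> U}" by (rule finite_measure_mono) (auto simp: V_def)
    then show ?thesis using le[of m] by simp
  qed
  ultimately have "prob (\<Union>m. V m) \<le> c" by (intro LIMSEQ_le_const2) auto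
  moreover have "{\<omega> \<in> space M. \<gamma> \<omega> \<in> U} \<subseteq> (\<Union>m. V m)"
  proof clarify
    fix \<omega> assume \<omega>: "\<omega> \<in> space M" "\<gamma> \<omega> \<in> U"
    have "\<forall>\<^sub>F n in sequentially. \<gamma>n n \<omega> \<in> U" using topological_tendstoD[OF lim[OF \<omega>(1)] U \<omega>(2)] .
    then show "\<omega> \<in> (\<Union>m. V m)" using \<omega> by (auto simp: V_def eventually_sequentially)
  qed
  then have "prob {\<omega> \<in> space M. \<gamma> \<omega> \<in> U} \<le> prob (\<Union>m. V m)" by (intro finite_measure_mono) auto
  ultimately show ?thesis by simp
qed

lemma le_0_of_le_const_div:
  assumes "\<And>N :: real. 0 < N \<Longrightarrow> x \<le> C / N" shows "x \<le> 0"
proof (rule LIMSEQ_le_const)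
  show "(\<lambda>n. C / real (Suc n)) \<longlonglongrightarrow> 0" 
    using LIMSEQ_Suc[OF lim_const_over_n[of C]] by simp
  show "\<exists>N. \<forall>n\<ge>N. x \<le> C / real (Suc n)" by (intro exI allI impI assms) simp
qed

text \<open>Weak limits need not preserve absolute continuity, but bounds that are uniform in \<open>n\<close> pass to the
  limit on open sets, and from there to Borel sets by regularity.\<close>

lemma (in prob_space) null_iff_limit:
  fixes \<beta> \<gamma> :: "'a \<Rightarrow> 'b::polish_space"
  assumes \<beta> [measurable]: "\<beta> \<in> borel_measurable M" and \<gamma> [measurable]: "\<gamma> \<in> borel_measurable M"
    and \<gamma>n [measurable]: "\<And>n. \<gamma>n n \<in> borel_measurable M"
    and lim: "\<And>\<omega>. \<omega> \<in> space M \<Longrightarrow> (\<lambda>n. \<gamma>n n \<omega>) \<longlonglongrightarrow> \<gamma> \<omega>"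
    and le1: "\<And>n N A. 0 < N \<Longrightarrow> A \<in> sets borel \<Longrightarrow>
      prob {\<omega> \<in> space M. \<beta> \<omega> \<in> A} \<le> N * prob {\<omega> \<in> space M. \<gamma>n n \<omega> \<in> A} + C / N"
    and le2: "\<And>n N A. 0 < N \<Longrightarrow> A \<in> sets borel \<Longrightarrow>
      prob {\<omega> \<in> space M. \<gamma>n n \<omega> \<in> A} \<le> N * prob {\<omega> \<in> space M. \<beta> \<omega> \<in> A} + C / N"
    and A [measurable]: "A \<in> sets borel"
  shows "prob {\<omega> \<in> space M. \<gamma> \<omega> \<in> A} = 0 \<longleftrightarrow> prob {\<omega> \<in> space M. \<beta> \<omega> \<in> A} = 0"
proof
  let ?P = "\<lambda>f A. prob {\<omega> \<in> space M. f \<omega> \<in> A}"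
  interpret D: prob_space "distr M borel \<beta>" by (rule prob_space_distr) simp
  have D: "emeasure (distr M borel \<beta>) X = ennreal (?P \<beta> X)" if "X \<in> sets borel" for X
    using that by (subst emeasure_distr) (auto simp: emeasure_eq_measure vimage_def Int_def conj_commute)
  {
    assume "?P \<beta> A = 0"
    have "?P \<gamma> A \<le> (1 + C) / N" if N: "0 < N" for N
    proof -
      \<comment> \<open>Outer regularity gives an open set so small that the factor \<open>N\<close>
        in \<open>le2\<close> still leaves \<open>1 / N\<close>; hence the threshold
        \<open>1 / N\<^sup>2\<close>.\<close>
      have "(INF U\<in>{U. A \<subseteq> U \<and> open U}. emeasure (distr M borel \<beta>) U) = 0"
        using outer_regular[of "distr M borel \<beta>" A] D[OF A] \<open>?P \<beta> A = 0\<close> D.emeasure_space_1 by simp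
      also have "0 < ennreal (1 / N\<^sup>2)" using N by simp
      finally obtain U where U: "A \<subseteq> U" "open U" "emeasure (distr M borel \<beta>) U < ennreal (1 / N\<^sup>2)"
        unfolding INF_less_iff by blast
      have [measurable]: "U \<in> sets borel" using U by simp
      have "?P \<beta> U \<le> 1 / N\<^sup>2"
        using U(3) D[of U] by (simp add: ennreal_less_iff)
      then have "N * ?P \<beta> U \<le> N * (1 / N\<^sup>2)" using N by (intro mult_left_mono) auto
      then have *: "N * ?P \<beta> U + C / N \<le> (1 + C) / N" using N
        by (simp add: power2_eq_square add_divide_distrib)
      have "?P \<gamma> A \<le> ?P \<gamma> U" using U by (intro finite_measure_mono) auto
      also have "\<dots> \<le> (1 + C) / N"
        by (rule prob_open_limit_le[OF \<gamma> \<gamma>n lim U(2)]) (auto intro: order_trans[OF le2[OF N] *])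
      finally show ?thesis .
    qed
    from le_0_of_le_const_div[OF this] show "?P \<gamma> A = 0" by (simp add: measure_le_0_iff)
  next
    assume 0: "?P \<gamma> A = 0"
    \<comment> \<open>Inner regularity reduces the claim to compact sets, whose complements are
      open.\<close>
    have "?P \<beta> K = 0" if K: "K \<subseteq> A" "compact K" for K
    proof -
      have [measurable]: "K \<in> sets borel" and "open (- K)" using K by (auto dest: compact_imp_closed)
      have compl: "?P f (- K) = 1 - ?P f K" if [measurable]: "f \<in> borel_measurable M" for f
      proof -
        have "{\<omega> \<in> space M. f \<omega> \<in> - K} = space M - {\<omega> \<in> space M. f \<omega> \<in> K}" by auto
        then show ?thesis by (simp add: prob_compl)
      qed
      have "?P \<gamma> K \<le> ?P \<gamma> A" using K by (intro finite_measure_mono) auto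
      then have "?P \<gamma> K = 0" using 0 by (simp add: measure_le_0_iff)
      then have \<gamma>1: "?P \<gamma> (- K) = 1" using compl[OF \<gamma>] by simp
      \<comment> \<open>Otherwise the complement of \<open>K\<close> would have probability at most
        \<open>1 - \<delta>\<close> for every \<open>n\<close>, hence also in the limit. One such
        \<open>n\<close> is enough because \<open>le1\<close> holds for each.\<close>
      have small: "\<exists>n. ?P (\<gamma>n n) K < \<delta>" if "0 < \<delta>" for \<delta>
      proof (rule ccontr)
        assume "\<not> (\<exists>n. ?P (\<gamma>n n) K < \<delta>)"
        then have "?P (\<gamma>n n) (- K) \<le> 1 - \<delta>" for n
          unfolding compl[OF \<gamma>n] by (simp add: not_less)
        from prob_open_limit_le[OF \<gamma> \<gamma>n lim \<open>open (- K)\<close> this] \<gamma>1 that show False by simp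
      qed
      have "?P \<beta> K \<le> (1 + C) / N" if N: "0 < N" for N
      proof -
        obtain n where "?P (\<gamma>n n) K < 1 / N\<^sup>2" using small[of "1 / N\<^sup>2"] N by auto
        then have "N * ?P (\<gamma>n n) K \<le> N * (1 / N\<^sup>2)" using N by (intro mult_left_mono) auto
        then have "N * ?P (\<gamma>n n) K + C / N \<le> (1 + C) / N" using N
          by (simp add: power2_eq_square add_divide_distrib)
        with le1[OF N, of K n] show ?thesis by simp
      qed
      from le_0_of_le_const_div[OF this] show "?P \<beta> K = 0" by (simp add: measure_le_0_iff)
    qed
    then have "emeasure (distr M borel \<beta>) K = 0" if "K \<subseteq> A" "compact K" for K
      using D[of K] that by (auto dest: compact_imp_closed)
    then have "(SUP K\<in>{K. K \<subseteq> A \<and> compact K}. emeasure (distr M borel \<beta>) K) \<le> 0"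
      by (intro SUP_least) simp
    then have "emeasure (distr M borel \<beta>) A = 0"
      using inner_regular[of "distr M borel \<beta>" A] D.emeasure_space_1 by simp
    then show "?P \<beta> A = 0" using D[OF A] by simp
  }
qed

subsection \<open>Equivalence of the laws\<close>

context time_scale
begin

text \<open>The gaps are disjoint intervals inside [0,1]. This is what makes the moment bounds
  independent of the number of gaps.\<close>

lemma sum_gaps_le:
  assumes "finite K" "K \<subseteq> left_scattered" shows "(\<Sum>r\<in>K. r - rho r) \<le> 1"
proof -
  have "(\<Sum>r\<in>K. r - rho r) = (\<Sum>r\<in>K. measure lborel {rho r<..r})"
    using assms left_scatteredD(2) by (intro sum.cong) (auto simp: less_imp_le)
  also have "\<dots> = measure lborel (\<Union>r\<in>K. {rho r<..r})"
  proof (rule measure_finite_Union[symmetric])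
    show "disjoint_family_on (\<lambda>r. {rho r<..r}) K"
      using assms(2) gaps_disjoint unfolding disjoint_family_on_def by blast
    show "emeasure lborel {rho r<..r} \<noteq> \<infinity>" if "r \<in> K" for r
      using less_imp_le[OF left_scatteredD(2)[OF subsetD[OF assms(2) that]]] by simp
  qed (use assms in auto)
  also have "\<dots> \<le> measure lborel {0..1 :: real}"
  proof (rule measure_mono_fmeasurable)
    show "(\<Union>r\<in>K. {rho r<..r}) \<subseteq> {0..1}"
      using assms left_scatteredD(4,5) by fastforce
  qed (use assms(1) in \<open>auto intro!: sets.finite_UN fmeasurableI\<close>)
  finally show ?thesis by simp
qed

text \<open>Since no point of \<open>T\<close> lies inside a gap, both ends of a gap are neighbours
  in any finite subset of \<open>T\<close> that contains them. Thus sums over gaps become sums over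
  grid steps.\<close>

lemma grid_exists:
  assumes G: "finite G" "G \<subseteq> T" "0 \<in> G" and K: "K \<subseteq> left_scattered" "K \<subseteq> G" "rho ` K \<subseteq> G"
  obtains u n where "u 0 = 0" "bij_betw u {..n} G" "\<And>i j. i < j \<Longrightarrow> j \<le> n \<Longrightarrow> u i < u j"
    "bij_betw (\<lambda>i. u (Suc i)) {i. i < n \<and> u (Suc i) \<in> K} K"
    "\<And>i. i < n \<Longrightarrow> u (Suc i) \<in> K \<Longrightarrow> u i = rho (u (Suc i))"
proof -
  define l where "l = sorted_list_of_set G"
  define n where "n = length l - 1"
  define u where "u = (!) l"
  have l: "set l = G" "sorted_wrt (<) l" "distinct l" using G by (auto simp: l_def)
  then have "l \<noteq> []" using G by auto
  then have len: "length l = Suc n" by (simp add: n_def)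
  have mono: "u i < u j" if "i < j" "j \<le> n" for i j
    using sorted_wrt_nth_less[OF l(2)] that len by (simp add: u_def)
  have bij: "bij_betw u {..n} G"
    using bij_betw_nth[OF l(3) _ l(1)[symmetric], of "{..n}"] len by (auto simp: u_def lessThan_Suc_atMost)
  then have mem: "u i \<in> G" if "i \<le> n" for i using that by (auto simp: bij_betw_def)
  have u0: "u 0 = 0"
  proof -
    obtain j where j: "j \<le> n" "u j = 0" using bij G(3) by (auto simp: bij_betw_def)
    then show ?thesis using mono[of 0 j] mem[of 0] G(2) T_bounds(1)[of "u 0"] by (cases "j = 0") auto
  qed
  have pred: "u i = rho (u (Suc i))" if i: "i < n" "u (Suc i) \<in> K" for i
  proof -
    note r = left_scatteredD[OF subsetD[OF K(1) i(2)]]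
    have "u i \<le> rho (u (Suc i))"
      using mem[of i] mono[of i "Suc i"] i G(2) by (intro rho_upper) auto
    moreover obtain j where j: "j \<le> n" "u j = rho (u (Suc i))"
      using bij K(3) i(2) by (auto simp: bij_betw_def image_subset_iff)
    moreover have "j \<le> i" using mono[of "Suc i" j] j r(2) by (cases j "Suc i" rule: linorder_cases) auto
    ultimately show ?thesis using mono[of j i] i by (cases "j = i") auto
  qed
  have "bij_betw (\<lambda>i. u (Suc i)) {i. i < n \<and> u (Suc i) \<in> K} K"
    unfolding bij_betw_def
  proof
    show "inj_on (\<lambda>i. u (Suc i)) {i. i < n \<and> u (Suc i) \<in> K}"
    proof (rule inj_onI)
      fix i j assume "i \<in> {i. i < n \<and> u (Suc i) \<in> K}" "j \<in> {i. i < n \<and> u (Suc i) \<in> K}" "u (Suc i) = u (Suc j)"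
      then show "i = j" using inj_onD[OF bij_betw_imp_inj_on[OF bij], of "Suc i" "Suc j"] by simp
    qed
    show "(\<lambda>i. u (Suc i)) ` {i. i < n \<and> u (Suc i) \<in> K} = K"
    proof (intro equalityI subsetI)
      fix r assume r: "r \<in> K"
      then obtain j where j: "j \<le> n" "u j = r" using bij K(2) by (auto simp: bij_betw_def)
      have "0 < r" using left_scatteredD(7) r K(1) by blast
      then have "j \<noteq> 0" using u0 j(2) by (intro notI) simp
      then obtain i where "j = Suc i" by (cases j) auto
      then show "r \<in> (\<lambda>i. u (Suc i)) ` {i. i < n \<and> u (Suc i) \<in> K}" using j r by auto
    qed auto
  qed
  with u0 bij mono pred show ?thesis by (intro that)
qed

end

section \<open>Change of measure along the Brownian path\<close>

locale drifted_brownian = sine_drift T a + gaussian_increments M T \<A> B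
  for T a and M :: "'w measure" and \<A> B +
  assumes sample_path_in_paths: "\<omega> \<in> space M \<Longrightarrow> sample_path T B \<omega> \<in> paths"
begin

text \<open>The logarithm of the stochastic exponential, integral of c dB minus half the integral of
  c^2 dt, for a coefficient that is constant on each gap of \<open>K\<close> and zero
  elsewhere.\<close>

definition log_density :: "real set \<Rightarrow> (real \<Rightarrow> 'w \<Rightarrow> real) \<Rightarrow> 'w \<Rightarrow> real" where
  "log_density K c \<omega> = (\<Sum>r\<in>K. c r \<omega> * (B r \<omega> - B (rho r) \<omega>) - (c r \<omega>)\<^sup>2 * (r - rho r) / 2)"

text \<open>The grid version with coefficient 0 on steps that are not gaps of \<open>K\<close> and
  factor 1 at times outside \<open>S\<close>.\<close>

lemma girsanov_gaps:
  assumes K: "finite K" "K \<subseteq> left_scattered" and c: "\<And>r. r \<in> K \<Longrightarrow> c r \<in> borel_measurable (\<A> (rho r))"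
    and S: "finite S" "S \<subseteq> T" and g: "\<And>t. g t \<in> borel_measurable borel"
  shows "(\<integral>\<^sup>+\<omega>. ennreal (exp (log_density K c \<omega>)) * (\<Prod>t\<in>S. g t (B t \<omega> - (\<Sum>r\<in>{r \<in> K. r \<le> t}. c r \<omega> * (r - rho r)))) \<partial>M)
       = (\<integral>\<^sup>+\<omega>. (\<Prod>t\<in>S. g t (B t \<omega>)) \<partial>M)"
proof -
  let ?G = "{0} \<union> S \<union> K \<union> rho ` K"
  have G: "finite ?G" "?G \<subseteq> T" "0 \<in> ?G" "K \<subseteq> ?G" "rho ` K \<subseteq> ?G"
  proof -
    have "K \<subseteq> T" "rho ` K \<subseteq> T" using K(2) left_scatteredD(1,3) by blast+
    then show "?G \<subseteq> T" using S(2) zero_mem by simp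
  qed (use K(1) S(1) in \<open>simp_all only: finite_Un finite_imageI finite.intros, blast+\<close>)
  obtain u n where u: "u 0 = 0" "bij_betw u {..n} ?G" "\<And>i j. i < j \<Longrightarrow> j \<le> n \<Longrightarrow> u i < u j"
    "bij_betw (\<lambda>i. u (Suc i)) {i. i < n \<and> u (Suc i) \<in> K} K"
    "\<And>i. i < n \<Longrightarrow> u (Suc i) \<in> K \<Longrightarrow> u i = rho (u (Suc i))"
    by (rule grid_exists[OF G(1-3) K(2) G(4,5)]) blast
  let ?I = "{i. i < n \<and> u (Suc i) \<in> K}"
  define c' where "c' i = (if u (Suc i) \<in> K then c (u (Suc i)) else (\<lambda>_. 0))" for i
  define g' where "g' i = (if u i \<in> S then g (u i) else (\<lambda>_. 1))" for i
  have dens: "(\<Prod>i<n. ennreal (exp (c' i \<omega> * (B (u (Suc i)) \<omega> - B (u i) \<omega>) - (c' i \<omega>)\<^sup>2 * (u (Suc i) - u i) / 2)))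
      = ennreal (exp (log_density K c \<omega>))" for \<omega>
  proof -
    have "(\<Prod>i<n. ennreal (exp (c' i \<omega> * (B (u (Suc i)) \<omega> - B (u i) \<omega>) - (c' i \<omega>)\<^sup>2 * (u (Suc i) - u i) / 2)))
       = (\<Prod>i\<in>?I. (\<lambda>r. ennreal (exp (c r \<omega> * (B r \<omega> - B (rho r) \<omega>) - (c r \<omega>)\<^sup>2 * (r - rho r) / 2))) (u (Suc i)))"
      by (rule prod.mono_neutral_cong_right) (auto simp: c'_def u(5))
    also have "\<dots> = (\<Prod>r\<in>K. ennreal (exp (c r \<omega> * (B r \<omega> - B (rho r) \<omega>) - (c r \<omega>)\<^sup>2 * (r - rho r) / 2)))"
      by (rule prod.reindex_bij_betw[OF u(4)])
    finally show ?thesis using K(1) by (simp add: log_density_def exp_sum prod_ennreal)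
  qed
  have shift: "(\<Sum>j<i. c' j \<omega> * (u (Suc j) - u j)) = (\<Sum>r\<in>{r \<in> K. r \<le> u i}. c r \<omega> * (r - rho r))"
    if i: "i \<le> n" for i \<omega>
  proof -
    have less: "u (Suc j) \<le> u i \<longleftrightarrow> j < i" if "j < n" for j
      using u(3)[of "Suc j" i] u(3)[of i "Suc j"] that i
      by (cases "Suc j" i rule: linorder_cases) auto
    have "bij_betw (\<lambda>i. u (Suc i)) {j \<in> ?I. j < i} {r \<in> K. r \<le> u i}"
    proof (rule bij_betw_subset[OF u(4)])
      show "(\<lambda>i. u (Suc i)) ` {j \<in> ?I. j < i} = {r \<in> K. r \<le> u i}"
      proof (intro equalityI subsetI)
        fix r assume "r \<in> {r \<in> K. r \<le> u i}"
        moreover from this obtain j where "j \<in> ?I" "r = u (Suc j)"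
          using bij_betw_imp_surj_on[OF u(4)] by blast
        ultimately show "r \<in> (\<lambda>i. u (Suc i)) ` {j \<in> ?I. j < i}" using less[of j] by simp
      qed (use less in auto)
    qed auto
    from sum.reindex_bij_betw[OF this, of "\<lambda>r. c r \<omega> * (r - rho r)"]
    have "(\<Sum>r\<in>{r \<in> K. r \<le> u i}. c r \<omega> * (r - rho r)) = (\<Sum>j\<in>{j \<in> ?I. j < i}. c (u (Suc j)) \<omega> * (u (Suc j) - rho (u (Suc j))))"
      by simp
    also have "\<dots> = (\<Sum>j<i. c' j \<omega> * (u (Suc j) - u j))"
      by (rule sum.mono_neutral_cong_left) (use i in \<open>auto simp: c'_def u(5)\<close>)
    finally show ?thesis by simp
  qed
  have prod: "(\<Prod>i\<le>n. g' i (y (u i))) = (\<Prod>t\<in>S. g t (y t))" for y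
  proof -
    have "(\<Prod>i\<le>n. g' i (y (u i))) = (\<Prod>i\<le>n. (\<lambda>t. if t \<in> S then g t (y t) else 1) (u i))"
      by (rule prod.cong) (auto simp: g'_def)
    also have "\<dots> = (\<Prod>t\<in>?G. if t \<in> S then g t (y t) else 1)"
      by (rule prod.reindex_bij_betw[OF u(2)])
    also have "\<dots> = (\<Prod>t\<in>S. g t (y t))"
      by (rule prod.mono_neutral_cong_right) (use G in auto)
    finally show ?thesis .
  qed
  have "(\<integral>\<^sup>+\<omega>. (\<Prod>i<n. ennreal (exp (c' i \<omega> * (B (u (Suc i)) \<omega> - B (u i) \<omega>) - (c' i \<omega>)\<^sup>2 * (u (Suc i) - u i) / 2)))
            * (\<Prod>i\<le>n. g' i (B (u i) \<omega> - (\<Sum>j<i. c' j \<omega> * (u (Suc j) - u j)))) \<partial>M)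
       = (\<integral>\<^sup>+\<omega>. (\<Prod>i\<le>n. g' i (B (u i) \<omega>)) \<partial>M)"
  proof (rule girsanov_grid)
    show "u i \<in> T" if "i \<le> n" for i
      using bij_betw_apply[OF u(2), of i] that by (intro subsetD[OF G(2)]) simp
    show "c' i \<in> borel_measurable (\<A> (u i))" if "i < n" for i
      using c u(5)[OF that] by (auto simp: c'_def)
  qed (use u g in \<open>auto simp: g'_def\<close>)
  moreover have "(\<Prod>i\<le>n. g' i (B (u i) \<omega> - (\<Sum>j<i. c' j \<omega> * (u (Suc j) - u j))))
      = (\<Prod>t\<in>S. g t (B t \<omega> - (\<Sum>r\<in>{r \<in> K. r \<le> t}. c r \<omega> * (r - rho r))))" for \<omega>
    unfolding prod[symmetric] by (rule prod.cong) (auto simp: shift)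
  moreover have "(\<Prod>i\<le>n. g' i (B (u i) \<omega>)) = (\<Prod>t\<in>S. g t (B t \<omega>))" for \<omega> by (rule prod)
  ultimately show ?thesis by (simp only: dens)
qed

text \<open>The force on the gap ending at \<open>r\<close>, taken along \<open>B\<close> and not
  along the solution; it is therefore known at time \<open>rho r\<close>.\<close>

definition coef :: "real \<Rightarrow> 'w \<Rightarrow> real" where
  "coef r \<omega> = a * sin (B (rho r) \<omega> - B (rho (rho r)) \<omega>)"

lemma coef_measurable:
  assumes "r \<in> left_scattered" shows "coef r \<in> borel_measurable (\<A> (rho r))"
proof -
  note r = left_scatteredD[OF assms]
  have [measurable]: "B (rho r) \<in> borel_measurable (\<A> (rho r))" by (rule adapted[OF r(3)])
  have [measurable]: "B (rho (rho r)) \<in> borel_measurable (\<A> (rho r))"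
    using measurable_later[OF rho_mem[OF r(4)] r(3) rho_le[OF r(4)] adapted[OF rho_mem[OF r(4)]]] .
  show ?thesis unfolding coef_def by measurable
qed

lemma log_density_measurable:
  assumes "K \<subseteq> left_scattered" "\<And>r. r \<in> K \<Longrightarrow> c r \<in> borel_measurable (\<A> (rho r))"
  shows "log_density K c \<in> borel_measurable M"
proof -
  have "c r \<in> borel_measurable M" "B r \<in> borel_measurable M" "B (rho r) \<in> borel_measurable M" if "r \<in> K" for r
    using assms that left_scatteredD(1,3)[of r] by (auto intro: measurable_whole B_measurable)
  then show ?thesis unfolding log_density_def
    by (intro borel_measurable_sum borel_measurable_diff borel_measurable_times borel_measurable_divide
        borel_measurable_power) auto
qed

lemma log_density_expectation:
  assumes "finite K" "K \<subseteq> left_scattered" "\<And>r. r \<in> K \<Longrightarrow> c r \<in> borel_measurable (\<A> (rho r))"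
  shows "(\<integral>\<^sup>+\<omega>. ennreal (exp (log_density K c \<omega>)) \<partial>M) = 1"
  using girsanov_gaps[OF assms, of "{}" "\<lambda>_ _. 1"] emeasure_space_1 by simp

lemma coef_square_sum_le:
  assumes "finite K" "K \<subseteq> left_scattered" shows "(\<Sum>r\<in>K. (coef r \<omega>)\<^sup>2 * (r - rho r)) \<le> 1"
proof -
  have "(coef r \<omega>)\<^sup>2 \<le> 1" for r
  proof -
    have "\<bar>coef r \<omega>\<bar> \<le> 1 * 1" unfolding coef_def abs_mult using a_less by (intro mult_mono) auto
    then show ?thesis by (simp add: abs_square_le_1)
  qed
  then have "(\<Sum>r\<in>K. (coef r \<omega>)\<^sup>2 * (r - rho r)) \<le> (\<Sum>r\<in>K. 1 * (r - rho r))"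
    using assms left_scatteredD(8) by (intro sum_mono mult_right_mono) (auto intro: less_imp_le)
  with sum_gaps_le[OF assms] show ?thesis by simp
qed

text \<open>The density with coefficients multiplied by \<open>\<kappa>\<close> also has mass 1. The cases \<open>\<kappa> = 2\<close> and \<open>\<kappa> = -1\<close>
  give the moments used in \<open>coords_prob_bounds\<close>.\<close>

lemma density_moment:
  assumes K: "finite K" "K \<subseteq> left_scattered" and \<kappa>: "\<kappa>\<^sup>2 - \<kappa> \<le> 2" "0 \<le> \<kappa>\<^sup>2 - \<kappa>"
  shows "(\<integral>\<^sup>+\<omega>. ennreal (exp (\<kappa> * log_density K coef \<omega>)) \<partial>M) \<le> ennreal (exp 1)"
proof -
  have "\<kappa> * log_density K coef \<omega> \<le> 1 + log_density K (\<lambda>r \<omega>. \<kappa> * coef r \<omega>) \<omega>" for \<omega>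
  proof -
    have "\<kappa> * log_density K coef \<omega> - log_density K (\<lambda>r \<omega>. \<kappa> * coef r \<omega>) \<omega>
        = (\<kappa>\<^sup>2 - \<kappa>) / 2 * (\<Sum>r\<in>K. (coef r \<omega>)\<^sup>2 * (r - rho r))"
      unfolding log_density_def sum_distrib_left sum_subtractf[symmetric]
      by (rule sum.cong) (auto simp: field_simps power2_eq_square)
    \<comment> \<open>For \<open>\<kappa> = 2\<close> and \<open>\<kappa> = -1\<close> alike the
      factor \<open>(\<kappa>\<^sup>2 - \<kappa>) / 2\<close> is exactly 1; this gives the constant
      \<open>exp 1\<close>.\<close>
    also have "\<dots> \<le> 1 * 1"
      using \<kappa> coef_square_sum_le[OF K] K left_scatteredD(8)
      by (intro mult_mono sum_nonneg mult_nonneg_nonneg) (auto intro: less_imp_le)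
    finally show ?thesis by simp
  qed
  then have "(\<integral>\<^sup>+\<omega>. ennreal (exp (\<kappa> * log_density K coef \<omega>)) \<partial>M)
      \<le> (\<integral>\<^sup>+\<omega>. ennreal (exp 1) * ennreal (exp (log_density K (\<lambda>r \<omega>. \<kappa> * coef r \<omega>) \<omega>)) \<partial>M)"
    by (intro nn_integral_mono) (simp add: ennreal_mult[symmetric] exp_add[symmetric] ennreal_leI)
  also have "\<dots> = ennreal (exp 1) * (\<integral>\<^sup>+\<omega>. ennreal (exp (log_density K (\<lambda>r \<omega>. \<kappa> * coef r \<omega>) \<omega>)) \<partial>M)"
  proof (rule nn_integral_cmult)
    have "log_density K (\<lambda>r \<omega>. \<kappa> * coef r \<omega>) \<in> borel_measurable M"
      using K by (intro log_density_measurable borel_measurable_times coef_measurable) auto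
    then show "(\<lambda>\<omega>. ennreal (exp (log_density K (\<lambda>r \<omega>. \<kappa> * coef r \<omega>) \<omega>))) \<in> borel_measurable M" by measurable
  qed
  also have "\<dots> = ennreal (exp 1)"
    using K by (subst log_density_expectation) (auto intro!: borel_measurable_times coef_measurable)
  finally show ?thesis .
qed

abbreviation path :: "'w \<Rightarrow> real \<Rightarrow> real" where
  "path \<equiv> sample_path T B"

lemma gap_drift_path: "K \<subseteq> left_scattered \<Longrightarrow> gap_drift K (path \<omega>) t = (\<Sum>r\<in>{r \<in> K. r \<le> t}. coef r \<omega> * (r - rho r))"
  unfolding gap_drift_def coef_def jump_def
  by (intro sum.cong) (auto simp: sample_path_def left_scatteredD(3) rho_mem left_scatteredD(4) subset_iff)

definition shifted_coords :: "real set \<Rightarrow> 'w \<Rightarrow> nat \<Rightarrow> real" where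
  "shifted_coords K \<omega> k = B (dense_seq k) \<omega> - gap_drift K (path \<omega>) (dense_seq k)"

lemma path_measurable: "t \<in> T \<Longrightarrow> (\<lambda>\<omega>. path \<omega> t) \<in> borel_measurable M"
  using B_measurable by (simp add: sample_path_def)

lemma path_coords_measurable [measurable]: "(\<lambda>\<omega>. coords (path \<omega>)) \<in> borel_measurable M"
  unfolding coords_def by (intro measurable_coordinatewise_then_product path_measurable dense_seq)

lemma shifted_coords_measurable:
  assumes "finite K" "K \<subseteq> left_scattered" shows "shifted_coords K \<in> borel_measurable M"
  unfolding shifted_coords_def
  by (intro measurable_coordinatewise_then_product borel_measurable_diff B_measurable
      gap_drift_measurable path_measurable dense_seq assms) auto

text \<open>Girsanov's theorem as an equality of laws of sequences: by \<open>girsanov_gaps\<close>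
  the two finite measures agree on cylinder sets, which determine them.\<close>

lemma density_coords:
  assumes K: "finite K" "K \<subseteq> left_scattered" and A: "A \<in> sets borel"
  shows "(\<integral>\<^sup>+\<omega>. ennreal (exp (log_density K coef \<omega>)) * indicator A (shifted_coords K \<omega>) \<partial>M)
    = emeasure M {\<omega> \<in> space M. coords (path \<omega>) \<in> A}"
proof -
  let ?D = "density M (\<lambda>\<omega>. ennreal (exp (log_density K coef \<omega>)))"
  have coef: "coef r \<in> borel_measurable (\<A> (rho r))" if "r \<in> K" for r
    using K that by (auto intro: coef_measurable)
  have [measurable]: "shifted_coords K \<in> borel_measurable M" by (rule shifted_coords_measurable[OF K])
  have [measurable]: "log_density K coef \<in> borel_measurable M"
    by (rule log_density_measurable[OF K(2) coef])
  have em: "emeasure (distr ?D borel (shifted_coords K)) X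
      = (\<integral>\<^sup>+\<omega>. ennreal (exp (log_density K coef \<omega>)) * indicator X (shifted_coords K \<omega>) \<partial>M)" if X: "X \<in> sets borel" for X
  proof -
    have [measurable]: "X \<in> sets borel" by fact
    have "emeasure (distr ?D borel (shifted_coords K)) X = emeasure ?D (shifted_coords K -` X \<inter> space M)"
      by (subst emeasure_distr) auto
    also have "\<dots> = (\<integral>\<^sup>+\<omega>. ennreal (exp (log_density K coef \<omega>)) * indicator (shifted_coords K -` X \<inter> space M) \<omega> \<partial>M)"
      by (rule emeasure_density) auto
    also have "\<dots> = (\<integral>\<^sup>+\<omega>. ennreal (exp (log_density K coef \<omega>)) * indicator X (shifted_coords K \<omega>) \<partial>M)"
      by (intro nn_integral_cong) (auto simp: indicator_def)
    finally show ?thesis .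
  qed
  have em2: "emeasure (distr M borel (\<lambda>\<omega>. coords (path \<omega>))) X = emeasure M {\<omega> \<in> space M. coords (path \<omega>) \<in> X}"
    if "X \<in> sets borel" for X
    using that by (subst emeasure_distr) (auto simp: vimage_def Int_def conj_commute)
  have "distr ?D borel (shifted_coords K) = distr M borel (\<lambda>\<omega>. coords (path \<omega>))"
  proof (rule measure_eqI_PiM_infinite[where I = UNIV and M = "\<lambda>_. borel"])
    show "sets (distr ?D borel (shifted_coords K)) = sets (Pi\<^sub>M UNIV (\<lambda>_. borel))"
      "sets (distr M borel (\<lambda>\<omega>. coords (path \<omega>))) = sets (Pi\<^sub>M UNIV (\<lambda>_. borel))"
      by (simp_all add: sets_PiM_equal_borel)
    have "emeasure (distr ?D borel (shifted_coords K)) UNIV = 1"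
      using em[of UNIV] log_density_expectation[OF K coef] by simp
    then show "finite_measure (distr ?D borel (shifted_coords K))"
      by (intro finite_measureI) simp
  next
    fix A :: "nat \<Rightarrow> real set" and J :: "nat set"
    assume J: "finite J" and A: "\<And>i. i \<in> J \<Longrightarrow> A i \<in> sets borel"
    let ?X = "prod_emb UNIV (\<lambda>_. borel) J (Pi\<^sub>E J A)"
    \<comment> \<open>\<open>dense_seq\<close> may repeat a time, as it must when \<open>T\<close>
      is finite, so all coordinates at the same time are collected into one factor.\<close>
    define g where "g t x = (\<Prod>k\<in>{k \<in> J. dense_seq k = t}. indicator (A k) x :: ennreal)" for t and x :: real
    have ind: "indicator ?X (\<lambda>k. y (dense_seq k)) = (\<Prod>t\<in>dense_seq ` J. g t (y t))" for y
    proof -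
      have "indicator ?X (\<lambda>k. y (dense_seq k)) = (\<Prod>k\<in>J. indicator (A k) (y (dense_seq k)) :: ennreal)"
      proof (cases "\<forall>k\<in>J. y (dense_seq k) \<in> A k")
        case True
        then have "(\<lambda>k. y (dense_seq k)) \<in> ?X" by (auto simp: prod_emb_def)
        with True show ?thesis by simp
      next
        case False
        then have "(\<lambda>k. y (dense_seq k)) \<notin> ?X" by (auto simp: prod_emb_def)
        moreover have "(\<Prod>k\<in>J. indicator (A k) (y (dense_seq k)) :: ennreal) = 0"
        proof -
          obtain k where "k \<in> J" "y (dense_seq k) \<notin> A k" using False by blast
          then show ?thesis using J by (intro prod_zero bexI[of _ k]) auto
        qed
        ultimately show ?thesis by simp
      qed
      also have "\<dots> = (\<Prod>t\<in>dense_seq ` J. \<Prod>k\<in>{k \<in> J. dense_seq k = t}. indicator (A k) (y (dense_seq k)))"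
        using J by (intro prod.group[symmetric]) auto
      also have "\<dots> = (\<Prod>t\<in>dense_seq ` J. g t (y t))"
        unfolding g_def by (intro prod.cong) auto
      finally show ?thesis .
    qed
    have X: "?X \<in> sets borel"
      using sets_PiM_I[of J UNIV A "\<lambda>_. borel"] J A by (simp add: sets_PiM_equal_borel)
    have g: "g t \<in> borel_measurable borel" for t
      unfolding g_def using A by (intro borel_measurable_prod_ennreal borel_measurable_indicator) auto
    have "emeasure (distr ?D borel (shifted_coords K)) ?X
        = (\<integral>\<^sup>+\<omega>. ennreal (exp (log_density K coef \<omega>)) *
          (\<Prod>t\<in>dense_seq ` J. g t (B t \<omega> - (\<Sum>r\<in>{r \<in> K. r \<le> t}. coef r \<omega> * (r - rho r)))) \<partial>M)"
      unfolding em[OF X] shifted_coords_def gap_drift_path[OF K(2)]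
      by (subst ind[of "\<lambda>t. B t _ - (\<Sum>r\<in>{r \<in> K. r \<le> t}. coef r _ * (r - rho r))"]) simp
    also have "\<dots> = (\<integral>\<^sup>+\<omega>. (\<Prod>t\<in>dense_seq ` J. g t (B t \<omega>)) \<partial>M)"
      using J dense_seq(1) by (intro girsanov_gaps K coef g) auto
    also have "\<dots> = (\<integral>\<^sup>+\<omega>. indicator ?X (coords (path \<omega>)) \<partial>M)"
      unfolding coords_def ind by (intro nn_integral_cong prod.cong) (auto simp: sample_path_def dense_seq)
    also have "\<dots> = (\<integral>\<^sup>+\<omega>. indicator {\<omega> \<in> space M. coords (path \<omega>) \<in> ?X} \<omega> \<partial>M)"
      by (intro nn_integral_cong) (auto simp: indicator_def)
    also have "\<dots> = emeasure (distr M borel (\<lambda>\<omega>. coords (path \<omega>))) ?X"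
      unfolding em2[OF X] using measurable_sets[OF path_coords_measurable X]
      by (intro nn_integral_indicator) (simp add: vimage_def Int_def conj_commute)
    finally show "emeasure (distr ?D borel (shifted_coords K)) ?X = emeasure (distr M borel (\<lambda>\<omega>. coords (path \<omega>))) ?X" .
  qed
  then show ?thesis using em[OF A] em2[OF A] by simp
qed

text \<open>Each bound splits the integrand by \<open>two_mult_le_add_square_div\<close>; the
  remainder is the second moment of the density in one direction and the expectation of its inverse
  in the other.\<close>

lemma coords_prob_bounds:
  assumes K: "finite K" "K \<subseteq> left_scattered" and A [measurable]: "A \<in> sets borel" and N: "0 < N"
  shows "prob {\<omega> \<in> space M. coords (path \<omega>) \<in> A} \<le> N * prob {\<omega> \<in> space M. shifted_coords K \<omega> \<in> A} + exp 1 / N" (is ?le1)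
    and "prob {\<omega> \<in> space M. shifted_coords K \<omega> \<in> A} \<le> N * prob {\<omega> \<in> space M. coords (path \<omega>) \<in> A} + exp 1 / N" (is ?le2)
proof -
  let ?E = "\<lambda>\<omega>. exp (log_density K coef \<omega>)"
  let ?S = "{\<omega> \<in> space M. shifted_coords K \<omega> \<in> A}"
  have [measurable]: "shifted_coords K \<in> borel_measurable M" by (rule shifted_coords_measurable[OF K])
  have [measurable]: "log_density K coef \<in> borel_measurable M"
    using K by (intro log_density_measurable coef_measurable) auto
  have ind: "(\<integral>\<^sup>+\<omega>. indicator A (shifted_coords K \<omega>) \<partial>M) = ennreal (prob ?S)"
  proof -
    have "(\<integral>\<^sup>+\<omega>. indicator A (shifted_coords K \<omega>) \<partial>M) = (\<integral>\<^sup>+\<omega>. indicator ?S \<omega> \<partial>M)"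
      by (intro nn_integral_cong) (auto simp: indicator_def)
    then show ?thesis by (simp add: emeasure_eq_measure)
  qed
  have moment: "ennreal (1 / N) * (\<integral>\<^sup>+\<omega>. ennreal (exp (\<kappa> * log_density K coef \<omega>)) \<partial>M) \<le> ennreal (exp 1 / N)"
    if "\<kappa> = 2 \<or> \<kappa> = -1" for \<kappa>
  proof -
    have "ennreal (1 / N) * (\<integral>\<^sup>+\<omega>. ennreal (exp (\<kappa> * log_density K coef \<omega>)) \<partial>M) \<le> ennreal (1 / N) * ennreal (exp 1)"
      using that by (intro mult_left_mono density_moment[OF K]) auto
    then show ?thesis using N by (simp add: ennreal_mult[symmetric])
  qed
  have "ennreal (prob {\<omega> \<in> space M. coords (path \<omega>) \<in> A}) = (\<integral>\<^sup>+\<omega>. ennreal (?E \<omega>) * indicator A (shifted_coords K \<omega>) \<partial>M)"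
    by (simp add: density_coords[OF K A] emeasure_eq_measure)
  also have "\<dots> \<le> (\<integral>\<^sup>+\<omega>. ennreal N * indicator A (shifted_coords K \<omega>) + ennreal (1 / N) * ennreal (exp (2 * log_density K coef \<omega>)) \<partial>M)"
  proof (intro nn_integral_mono)
    fix \<omega>
    have "?E \<omega> \<le> 2 * ?E \<omega>" by simp
    also have "\<dots> \<le> N + (?E \<omega>)\<^sup>2 / N" by (rule two_mult_le_add_square_div[OF N])
    finally have "?E \<omega> \<le> N + 1 / N * exp (2 * log_density K coef \<omega>)"
      by (simp add: exp_double)
    then show "ennreal (?E \<omega>) * indicator A (shifted_coords K \<omega>)
        \<le> ennreal N * indicator A (shifted_coords K \<omega>) + ennreal (1 / N) * ennreal (exp (2 * log_density K coef \<omega>))"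
      using N by (simp add: indicator_def ennreal_mult[symmetric] ennreal_plus[symmetric] ennreal_leI del: ennreal_plus)
  qed
  also have "\<dots> = ennreal N * (\<integral>\<^sup>+\<omega>. indicator A (shifted_coords K \<omega>) \<partial>M) + ennreal (1 / N) * (\<integral>\<^sup>+\<omega>. ennreal (exp (2 * log_density K coef \<omega>)) \<partial>M)"
    by (simp add: nn_integral_add nn_integral_cmult)
  also have "\<dots> \<le> ennreal N * ennreal (prob ?S) + ennreal (exp 1 / N)"
    unfolding ind by (intro add_mono moment) auto
  finally show ?le1
    using N by (simp add: ennreal_mult[symmetric] ennreal_plus[symmetric] del: ennreal_plus)
  have "ennreal (prob ?S) = (\<integral>\<^sup>+\<omega>. indicator A (shifted_coords K \<omega>) \<partial>M)" by (simp add: ind)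
  also have "\<dots> \<le> (\<integral>\<^sup>+\<omega>. ennreal N * (ennreal (?E \<omega>) * indicator A (shifted_coords K \<omega>)) + ennreal (1 / N) * ennreal (exp (- 1 * log_density K coef \<omega>)) \<partial>M)"
  proof (intro nn_integral_mono)
    fix \<omega>
    \<comment> \<open>The inequality is used at the point 1, with \<open>N\<close> times the density
      in place of \<open>N\<close>, so that the inverse density appears.\<close>
    have "2 * 1 \<le> N * ?E \<omega> + 1\<^sup>2 / (N * ?E \<omega>)" using N by (intro two_mult_le_add_square_div) simp
    then have "1 \<le> N * ?E \<omega> + 1 / N * exp (- 1 * log_density K coef \<omega>)"
      by (simp add: exp_minus field_simps)
    then show "indicator A (shifted_coords K \<omega>)
        \<le> ennreal N * (ennreal (?E \<omega>) * indicator A (shifted_coords K \<omega>)) + ennreal (1 / N) * ennreal (exp (- 1 * log_density K coef \<omega>))"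
      using N by (simp add: indicator_def ennreal_mult[symmetric] ennreal_plus[symmetric] ennreal_leI
        ennreal_1[symmetric] del: ennreal_plus ennreal_1)
  qed
  also have "\<dots> = ennreal N * (\<integral>\<^sup>+\<omega>. ennreal (?E \<omega>) * indicator A (shifted_coords K \<omega>) \<partial>M) + ennreal (1 / N) * (\<integral>\<^sup>+\<omega>. ennreal (exp (- 1 * log_density K coef \<omega>)) \<partial>M)"
    by (simp add: nn_integral_add nn_integral_cmult)
  also have "\<dots> \<le> ennreal N * ennreal (prob {\<omega> \<in> space M. coords (path \<omega>) \<in> A}) + ennreal (exp 1 / N)"
    unfolding density_coords[OF K A] emeasure_eq_measure by (intro add_mono moment) auto
  finally show ?le2
    using N by (simp add: ennreal_mult[symmetric] ennreal_plus[symmetric] del: ennreal_plus)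
qed

lemma path_path_borel: "path \<in> M \<rightarrow>\<^sub>M path_borel T"
  by (rule measurable_path_borel) (auto intro: sample_path_in_paths path_measurable)

text \<open>In coordinates the truncated shifts converge for every sample point, and
  \<open>null_iff_limit\<close> applies with the constant \<open>exp 1\<close>.\<close>

lemma null_unshift_iff:
  assumes A: "A \<in> sets (path_borel T)"
  shows "prob {\<omega> \<in> space M. unshift (path \<omega>) \<in> A} = 0 \<longleftrightarrow> prob {\<omega> \<in> space M. path \<omega> \<in> A} = 0"
proof -
  obtain A' where A': "A' \<in> sets borel" "A = {w \<in> paths. coords w \<in> A'}" using path_borel_coords[OF A] by metis
  obtain K :: "nat \<Rightarrow> real set" where K: "\<And>n. finite (K n)" "\<And>n. K n \<subseteq> left_scattered"
    "\<And>r. r \<in> left_scattered \<Longrightarrow> \<forall>\<^sub>F n in sequentially. r \<in> K n"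
    using left_scattered_exhaustion by metis
  have "prob {\<omega> \<in> space M. coords (unshift (path \<omega>)) \<in> A'} = 0 \<longleftrightarrow> prob {\<omega> \<in> space M. coords (path \<omega>) \<in> A'} = 0"
  proof (rule null_iff_limit[where C = "exp 1" and \<gamma>n = "\<lambda>n. shifted_coords (K n)"])
    have "(\<lambda>\<omega>. unshift (path \<omega>)) \<in> M \<rightarrow>\<^sub>M path_filtration T 1"
      using measurable_compose[OF path_path_borel unshift_path_borel] measurable_cong_sets[OF refl sets_path_borel]
      by blast
    then show "(\<lambda>\<omega>. coords (unshift (path \<omega>))) \<in> borel_measurable M"
      by (rule measurable_compose[OF _ coords_measurable])
    show "shifted_coords (K n) \<in> borel_measurable M" for n by (rule shifted_coords_measurable[OF K(1,2)])
    show "(\<lambda>n. shifted_coords (K n) \<omega>) \<longlonglongrightarrow> coords (unshift (path \<omega>))" for \<omega>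
    proof (rule tendsto_funI)
      fix k
      have "(\<lambda>n. B (dense_seq k) \<omega> - gap_drift (K n) (path \<omega>) (dense_seq k)) \<longlonglongrightarrow> B (dense_seq k) \<omega> - drift (path \<omega>) (dense_seq k)"
        by (intro tendsto_intros gap_drift_tendsto K dense_seq)
      then show "(\<lambda>n. shifted_coords (K n) \<omega> k) \<longlonglongrightarrow> coords (unshift (path \<omega>)) k"
        by (simp add: shifted_coords_def coords_def unshift_def dense_seq sample_path_def)
    qed
  qed (use coords_prob_bounds K(1,2) A' in auto)
  moreover have "{\<omega> \<in> space M. unshift (path \<omega>) \<in> A} = {\<omega> \<in> space M. coords (unshift (path \<omega>)) \<in> A'}"
    using A'(2) unshift_in_paths sample_path_in_paths by auto
  moreover have "{\<omega> \<in> space M. path \<omega> \<in> A} = {\<omega> \<in> space M. coords (path \<omega>) \<in> A'}"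
    using A'(2) sample_path_in_paths by auto
  ultimately show ?thesis by simp
qed

text \<open>Apply \<open>null_unshift_iff\<close> to the preimage of \<open>A\<close> under
  \<open>solution\<close>: as \<open>solution\<close> undoes \<open>unshift\<close>, the two events
  there become those of the claim, in exchanged order.\<close>

lemma null_solution_iff:
  assumes A: "A \<in> sets (path_borel T)"
  shows "prob {\<omega> \<in> space M. solution (path \<omega>) \<in> A} = 0 \<longleftrightarrow> prob {\<omega> \<in> space M. path \<omega> \<in> A} = 0"
proof -
  have "solution -` A \<inter> paths \<in> sets (path_borel T)"
    using measurable_sets[OF solution_path_borel A] by simp
  from null_unshift_iff[OF this] show ?thesis
    by (simp add: sample_path_in_paths unshift_in_paths solution_unshift_path cong: conj_cong)
qed

end

section \<open>From conditional characteristic functions to the theorem\<close>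

lemma (in prob_space) complex_cond_exp_iexp_moment:
  assumes F: "subalgebra M F" and D [measurable]: "D \<in> borel_measurable M" and A: "A \<in> sets F"
    and ce: "AE \<omega> in M. complex_cond_exp M F (\<lambda>x. exp (\<i> * complex_of_real (\<theta> * D x))) \<omega> = complex_of_real c"
  shows "(CLINT x|M. indicator A x *\<^sub>R iexp (\<theta> * D x)) = complex_of_real (c * prob A)"
proof -
  interpret F: finite_measure_subalgebra M F by unfold_locales (rule F)
  have AM [measurable]: "A \<in> sets M" using A F by (auto simp: subalgebra_def)
  have int: "(\<integral>x. indicator A x * f x \<partial>M) = d * prob A"
    if f: "f \<in> borel_measurable M" "\<And>x. \<bar>f x\<bar> \<le> 1" and d: "AE x in M. real_cond_exp M F f x = d" for f d
  proof -
    have "integrable M f" by (rule integrable_const_bound[where B = 1]) (use f in auto)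
    then have "(LINT x:A|M. f x) = (LINT x:A|M. real_cond_exp M F f x)" by (rule F.real_cond_exp_intA[OF _ A])
    also have "\<dots> = (LINT x:A|M. d)"
      unfolding set_lebesgue_integral_def by (rule integral_cong_AE) (use d in auto)
    also have "\<dots> = d * prob A" using set_integral_const[OF AM, of d] by simp
    finally show ?thesis by (simp add: set_lebesgue_integral_def)
  qed
  have ae: "AE x in M. real_cond_exp M F (\<lambda>x. cos (\<theta> * D x)) x = c" "AE x in M. real_cond_exp M F (\<lambda>x. sin (\<theta> * D x)) x = 0"
    using ce by (auto elim!: eventually_mono simp: complex_cond_exp_def complex_eq_iff Re_exp Im_exp)
  have cos: "(\<integral>x. indicator A x * cos (\<theta> * D x) \<partial>M) = c * prob A"
    and sin: "(\<integral>x. indicator A x * sin (\<theta> * D x) \<partial>M) = 0 * prob A"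
    by (rule int[OF _ _ ae(1)]; simp) (rule int[OF _ _ ae(2)]; simp)
  have intg: "integrable M (\<lambda>x. indicator A x *\<^sub>R iexp (\<theta> * D x))"
    by (rule integrable_const_bound[where B = 1]) (auto simp: indicator_def)
  show ?thesis
  proof (rule complex_eqI)
    show "Re (CLINT x|M. indicator A x *\<^sub>R iexp (\<theta> * D x)) = Re (complex_of_real (c * prob A))"
      unfolding integral_Re[OF intg, symmetric] using cos by (simp add: Re_exp)
    show "Im (CLINT x|M. indicator A x *\<^sub>R iexp (\<theta> * D x)) = Im (complex_of_real (c * prob A))"
      unfolding integral_Im[OF intg, symmetric] using sin by (simp add: Im_exp)
  qed
qed

lemma drifted_brownian_of_filtered:
  fixes T :: "real set" and P :: "'w measure"
  assumes T: "closed T" "{0, 1} \<subseteq> T" "T \<subseteq> {0..1}" and a: "a \<in> {-1<..<1}"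
    and P: "complete_filtered_prob_space T P \<A>" and B: "filtered_sampled_brownian_motion T P \<A> B"
  shows "drifted_brownian T a P \<A> B"
proof -
  interpret sine_drift T a using T a by unfold_locales auto
  interpret prob_space P using P by (simp add: complete_filtered_prob_space_def)
  have sub: "subalgebra P (\<A> t)" if "t \<in> T" for t using P that by (simp add: complete_filtered_prob_space_def)
  have path: "sample_path T B \<omega> \<in> paths" if "\<omega> \<in> space P" for \<omega>
    using B that measurable_space[of "sample_path T B" P "path_borel T" \<omega>]
    by (simp add: filtered_sampled_brownian_motion_def sampled_brownian_motion_def path_process_def)
  have ad: "B t \<in> borel_measurable (\<A> t)" if "t \<in> T" for t
    using B that by (simp add: filtered_sampled_brownian_motion_def adapted_process_def)
  show ?thesis
  proof unfold_locales
    fix s t A and U :: "real set"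
    assume st: "s \<in> T" "t \<in> T" "s < t" and A: "A \<in> sets (\<A> s)" and U: "U \<in> sets borel"
    have D: "(\<lambda>\<omega>. B t \<omega> - B s \<omega>) \<in> borel_measurable P"
      using measurable_from_subalg[OF sub ad] st by simp
    have AP: "A \<in> sets P" using A sub[OF st(1)] by (auto simp: subalgebra_def)
    show "emeasure P (A \<inter> ((\<lambda>\<omega>. B t \<omega> - B s \<omega>) -` U \<inter> space P)) = emeasure P A * emeasure (gauss (t - s)) U"
    proof (rule iexp_moment_imp_indep_gauss[OF D AP U])
      show "0 < t - s" using st by simp
      show "(CLINT x|P. indicator A x *\<^sub>R iexp (\<theta> * (B t x - B s x))) = complex_of_real (exp (- (t - s) * \<theta>\<^sup>2 / 2) * prob A)" for \<theta>
        by (rule complex_cond_exp_iexp_moment[OF sub[OF st(1)] D A])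
          (use B st in \<open>simp add: filtered_sampled_brownian_motion_def\<close>)
    qed
  next
    show "\<omega> \<in> space P \<Longrightarrow> B 0 \<omega> = 0" for \<omega>
      using path[of \<omega>] zero_mem by (simp add: paths_iff sample_path_def)
  qed (use P ad sub path zero_mem in \<open>auto simp: complete_filtered_prob_space_def\<close>)
qed

theorem corollary6p2:
  fixes T :: "real set" and a :: real
    and P :: "'w measure" and \<A> :: "real \<Rightarrow> 'w measure" and B :: "real \<Rightarrow> 'w \<Rightarrow> real"
  assumes "closed T" and "{0, 1} \<subseteq> T" and "T \<subseteq> {0..1}"
    and "a \<in> {-1<..<1}"
    and "complete_filtered_prob_space T P \<A>"
    and "filtered_sampled_brownian_motion T P \<A> B"
  shows "\<exists>X. strong_solution T P \<A> B (sine_equation T a) X \<and>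
             path_process T P X \<and>
             equivalent_measures (path_law T P X) (sampled_wiener T)"
proof -
  interpret drifted_brownian T a P \<A> B by (rule drifted_brownian_of_filtered[OF assms])
  \<comment> \<open>Defined through the solution map on the whole sample space, so the equation and
    the representation by \<open>solution\<close> hold for every sample point.\<close>
  define X where "X t \<omega> = solution (path \<omega>) t" for t \<omega>
  have law: "path_law T P B = sampled_wiener T"
    using assms(6) by (simp add: filtered_sampled_brownian_motion_def sampled_brownian_motion_def)
  have X_path: "sample_path T X = (\<lambda>\<omega>. solution (path \<omega>))"
    by (auto simp: fun_eq_iff sample_path_def X_def solution_def)
  have X_meas: "(\<lambda>\<omega>. solution (path \<omega>)) \<in> P \<rightarrow>\<^sub>M path_borel T"
    by (rule measurable_compose[OF path_path_borel solution_path_borel])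
  have adapted_X: "X t \<in> borel_measurable (\<A> t)" if t: "t \<in> T" for t
    unfolding X_def
  proof (rule solution_measurable[OF t])
    fix s assume "s \<in> T" "s \<le> t"
    then show "(\<lambda>\<omega>. path \<omega> s) \<in> borel_measurable (\<A> t)"
      using measurable_later[OF _ t _ adapted] by (simp add: sample_path_def)
  qed
  have eqn: "sine_equation T a (\<lambda>t. X t \<omega>) (\<lambda>t. B t \<omega>)" for \<omega>
    unfolding sine_equation_iff X_def using solution_eq[of _ "path \<omega>"] by (simp add: sample_path_def)
  have aug: "solution -` U \<inter> paths \<in> sets (augmented_path_filtration T (sampled_wiener T) t)"
    if "U \<in> sets (path_filtration T t)" for U t
  proof -
    \<comment> \<open>\<open>sigma\<close> generates the intended field only from subsets of its
      space. The null sets are such subsets because \<open>sampled_wiener T\<close> is the law of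
      \<open>B\<close> on \<open>path_borel T\<close>.\<close>
    have "sets (path_filtration T t) \<union> null_sets (completion (sampled_wiener T)) \<subseteq> Pow paths"
      using sets.sets_into_space[of _ "path_filtration T t"]
        sets.sets_into_space[of _ "completion (sampled_wiener T)"]
      by (fastforce simp: law[symmetric] path_law_def null_sets_def)
    moreover have "solution -` U \<inter> paths \<in> sets (path_filtration T t)"
      using measurable_sets[OF solution_adapted that] by simp
    ultimately show ?thesis unfolding augmented_path_filtration_def by (subst sets_measure_of) auto
  qed
  have "strong_solution T P \<A> B (sine_equation T a) X"
    unfolding strong_solution_def adapted_process_def
    using adapted_X eqn aug solution_path_borel by (auto simp: X_def intro!: bexI[of _ solution])
  moreover have "path_process T P X" unfolding path_process_def X_path by (rule X_meas)
  moreover have "equivalent_measures (path_law T P X) (sampled_wiener T)"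
  proof -
    have "A \<in> null_sets (path_law T P X) \<longleftrightarrow> A \<in> null_sets (path_law T P B)" for A
    proof (cases "A \<in> sets (path_borel T)")
      case True
      have "emeasure (distr P (path_borel T) Y) A = ennreal (prob {\<omega> \<in> space P. Y \<omega> \<in> A})"
        if "Y \<in> P \<rightarrow>\<^sub>M path_borel T" for Y
        using that True by (subst emeasure_distr) (auto simp: emeasure_eq_measure vimage_def Int_def conj_commute)
      from this[OF X_meas] this[OF path_path_borel] null_solution_iff[OF True] True show ?thesis
        by (simp add: path_law_def X_path null_sets_def)
    qed (simp add: path_law_def null_sets_def)
    then show ?thesis
      unfolding equivalent_measures_def law[symmetric] absolutely_continuous_def
      by (auto simp: path_law_def)
  qed
  ultimately show ?thesis by blast
qed

end
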